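(* Let $1<p<\infty$, and let $\Omega$ and $\Upsilon$ be regular domains in $\mathbb{R}^d$, with boundary decompositions $\partial\Omega=\partial\Omega_D\cup\partial\Omega_N$ and $\partial\Upsilon=\partial\Upsilon_D\cup\partial\Upsilon_N$, such that $\Omega\subset\Upsilon$. Let $u_1=u_1(\Upsilon,\partial\Upsilon_D,p)>0$ on $\Omega$ be a fundamental eigenfunction for the $p$-Laplacian with respect to $\Upsilon,\partial\Upsilon_D$. If $\nu\cdot\nabla u_1\ge 0$ a.e. on $\partial\Omega_N$, where $\nu$ is the outward unit normal of $\Omega$, then $$\lambda_1(\Omega,\partial\Omega_D,p)\ \ge\ \lambda_1(\Upsilon,\partial\Upsilon_D,p).$$
   Context: A bounded domain $\Omega\subset\mathbb{R}^d$ has boundary consisting of two pieces, $\partial\Omega_D$ and $\partial\Omega_N:=\partial\Omega\setminus\partial\Omega_D$, each of positive $(d-1)$-dimensional surface measure. $\Omega$ is called regular if its boundary is of class $C$ (locally, in suitable Cartesian coordinates, $\partial\Omega$ is the graph of a continuous function with $\Omega$ lying on one side of it) and is $C^1$ a.e. with respect to surface measure. The outward unit normal $\nu$ exists a.e. on $\partial\Omega_N$. Standing assumption: the boundary is sufficiently regular that Green's formula (the Gauss–Green/divergence theorem) is valid on $\Omega$ for the test functions considered. Test functions: $\mathcal{D}(\Omega,\partial\Omega_D)$ is the set of restrictions to $\Omega$ of (real-valued) functions in $C_c^\infty(\mathbb{R}^d\setminus\partial\Omega_D)$; no boundary condition is imposed on $\partial\Omega_N$. The fundamental eigenvalue of the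 $p$-Laplacian with respect to $\Omega,\partial\Omega_D$ is $$\lambda_1(\Omega,\partial\Omega_D,p):=\inf\left\{\frac{\int_\Omega|\nabla\zeta|^p\,dx}{\int_\Omega|\zeta|^p\,dx}:\ \zeta\in\mathcal{D}(\Omega,\partial\Omega_D),\ \zeta\not\equiv 0\right\}.$$ The same notation is used for $\Upsilon$. A fundamental eigenfunction $u_1$ for $\Upsilon,\partial\Upsilon_D$ is a minimiser of the corresponding quotient (in the appropriate Sobolev space); it satisfies $-\operatorname{div}(|\nabla u_1|^{p-2}\nabla u_1)=\lambda_1(\Upsilon,\partial\Upsilon_D,p)\,u_1^{p-1}$ where it is positive. *)

theory Defs
  imports "HOL-Analysis.Analysis"
begin

section \<open>Smooth functions and test functions\<close>

definition grad :: "('a::euclidean_space \<Rightarrow> real) \<Rightarrow> 'a \<Rightarrow> 'a" where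
  "grad f x = (\<Sum>b\<in>Basis. frechet_derivative f (at x) b *\<^sub>R b)"

fun Ck :: "nat \<Rightarrow> ('a::euclidean_space \<Rightarrow> real) \<Rightarrow> bool" where
  "Ck 0 f \<longleftrightarrow> continuous_on UNIV f"
| "Ck (Suc k) f \<longleftrightarrow> (\<forall>x. f differentiable (at x)) \<and> (\<forall>b\<in>Basis. Ck k (\<lambda>x. grad f x \<bullet> b))"

definition Cinf :: "('a::euclidean_space \<Rightarrow> real) \<Rightarrow> bool" where
  "Cinf f \<longleftrightarrow> (\<forall>k. Ck k f)"

definition supp :: "('a::euclidean_space \<Rightarrow> real) \<Rightarrow> 'a set" where
  "supp f = closure {x. f x \<noteq> 0}"

text \<open>Functions in \<open>C\<^sub>c\<^sup>\<infinity>(A)\<close>, extended by zero to the whole space.\<close>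

definition Ccinf :: "'a::euclidean_space set \<Rightarrow> ('a \<Rightarrow> real) set" where
  "Ccinf A = {\<phi>. Cinf \<phi> \<and> compact (supp \<phi>) \<and> supp \<phi> \<subseteq> A}"

text \<open>The elements of \<open>\<D>(\<Omega>, \<partial>\<Omega>\<^sub>D)\<close> are the restrictions to \<open>\<Omega>\<close> of the members of
  \<open>Ccinf (- \<partial>\<Omega>\<^sub>D)\<close>.  Below they are represented by these extensions, and only
  their values on the closure of \<open>\<Omega>\<close> are ever used.\<close>

definition rayleigh :: "'a::euclidean_space set \<Rightarrow> real \<Rightarrow> ('a \<Rightarrow> real) \<Rightarrow> ('a \<Rightarrow> 'a) \<Rightarrow> real" where
  "rayleigh S p u Du =
     (LINT x:S|lebesgue. norm (Du x) powr p) / (LINT x:S|lebesgue. \<bar>u x\<bar> powr p)"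

definition lambda1 :: "'a::euclidean_space set \<Rightarrow> 'a set \<Rightarrow> real \<Rightarrow> real" where
  "lambda1 S D p =
     Inf {rayleigh S p \<zeta> (grad \<zeta>) | \<zeta>. \<zeta> \<in> Ccinf (- D) \<and> (\<exists>x\<in>S. \<zeta> x \<noteq> 0)}"

section \<open>Sobolev spaces and fundamental eigenfunctions\<close>

definition Lp_on :: "'a::euclidean_space set \<Rightarrow> real \<Rightarrow> ('a \<Rightarrow> 'b::euclidean_space) \<Rightarrow> bool" where
  "Lp_on S p f \<longleftrightarrow> set_borel_measurable lebesgue S f
     \<and> set_integrable lebesgue S (\<lambda>x. norm (f x) powr p)"

definition weak_gradient_on :: "'a::euclidean_space set \<Rightarrow> ('a \<Rightarrow> real) \<Rightarrow> ('a \<Rightarrow> 'a) \<Rightarrow> bool" where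
  "weak_gradient_on S u Du \<longleftrightarrow> (\<forall>\<phi>\<in>Ccinf S. \<forall>b\<in>Basis.
     (LINT x:S|lebesgue. u x * (grad \<phi> x \<bullet> b)) = - (LINT x:S|lebesgue. (Du x \<bullet> b) * \<phi> x))"

text \<open>\<open>u \<in> W\<^sup>1\<^sup>,\<^sup>p(S)\<close> with weak gradient \<open>Du\<close>.\<close>

definition W1p :: "'a::euclidean_space set \<Rightarrow> real \<Rightarrow> ('a \<Rightarrow> real) \<Rightarrow> ('a \<Rightarrow> 'a) \<Rightarrow> bool" where
  "W1p S p u Du \<longleftrightarrow> Lp_on S p u \<and> Lp_on S p Du \<and> weak_gradient_on S u Du"

text \<open>The closure of \<open>\<D>(S, D)\<close> in \<open>W\<^sup>1\<^sup>,\<^sup>p(S)\<close>.\<close>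

definition W1p_D :: "'a::euclidean_space set \<Rightarrow> 'a set \<Rightarrow> real \<Rightarrow> ('a \<Rightarrow> real) \<Rightarrow> ('a \<Rightarrow> 'a) \<Rightarrow> bool" where
  "W1p_D S D p u Du \<longleftrightarrow> W1p S p u Du \<and>
     (\<exists>\<zeta>. (\<forall>n. \<zeta> n \<in> Ccinf (- D)) \<and>
       (\<lambda>n. (LINT x:S|lebesgue. \<bar>u x - \<zeta> n x\<bar> powr p)
          + (LINT x:S|lebesgue. norm (Du x - grad (\<zeta> n) x) powr p)) \<longlonglongrightarrow> 0)"

definition nontrivial_on :: "'a::euclidean_space set \<Rightarrow> ('a \<Rightarrow> real) \<Rightarrow> bool" where
  "nontrivial_on S u \<longleftrightarrow> \<not> (AE x in lebesgue. x \<in> S \<longrightarrow> u x = 0)"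

definition fundamental_eigenfunction ::
    "'a::euclidean_space set \<Rightarrow> 'a set \<Rightarrow> real \<Rightarrow> ('a \<Rightarrow> real) \<Rightarrow> ('a \<Rightarrow> 'a) \<Rightarrow> bool" where
  "fundamental_eigenfunction S D p u Du \<longleftrightarrow> W1p_D S D p u Du \<and> nontrivial_on S u \<and>
     (\<forall>v Dv. W1p_D S D p v Dv \<and> nontrivial_on S v \<longrightarrow> rayleigh S p u Du \<le> rayleigh S p v Dv)"

section \<open>Surface measure\<close>

text \<open>The \<open>k\<close>-dimensional Hausdorff outer measure, normalised so that it agrees with
  surface area on \<open>C\<^sup>1\<close> surfaces.  The empty set has to be treated separately because
  \<open>0 ^ 0 = 1\<close>, which is the correct value for singletons when \<open>k = 0\<close>.\<close>

definition hausdorff_outer :: "nat \<Rightarrow> 'a::euclidean_space set \<Rightarrow> ennreal" where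
  "hausdorff_outer k A =
     (SUP \<delta>\<in>{0<..}. INF U\<in>{U :: nat \<Rightarrow> 'a set. A \<subseteq> (\<Union>i. U i) \<and>
                                    (\<forall>i. bounded (U i) \<and> diameter (U i) \<le> \<delta>)}.
        \<Sum>i. if U i = {} then 0
            else ennreal (unit_ball_vol (real k) * (diameter (U i) / 2) ^ k))"

definition surface_measure :: "'a::euclidean_space measure" where
  "surface_measure =
     completion (measure_of UNIV (sets borel) (hausdorff_outer (DIM('a) - 1)))"

section \<open>Regular domains with a decomposed boundary\<close>

definition tangential :: "'a::euclidean_space \<Rightarrow> 'a \<Rightarrow> 'a" where
  "tangential e x = x - (x \<bullet> e) *\<^sub>R e"

text \<open>In the open set \<open>V\<close>, the boundary of \<open>S\<close> is the graph, over the hyperplane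
  orthogonal to the unit vector \<open>e\<close>, of \<open>g\<close>, and \<open>S\<close> is the part below the graph.  Only
  the values of \<open>g\<close> on the hyperplane matter.\<close>

definition graph_chart ::
    "'a::euclidean_space set \<Rightarrow> 'a set \<Rightarrow> 'a \<Rightarrow> ('a \<Rightarrow> real) \<Rightarrow> bool" where
  "graph_chart S V e g \<longleftrightarrow> open V \<and> norm e = 1 \<and>
     (\<forall>x\<in>V. (x \<in> frontier S \<longleftrightarrow> x \<bullet> e = g (tangential e x)) \<and>
            (x \<in> S \<longleftrightarrow> x \<bullet> e < g (tangential e x)))"

definition boundary_class_C :: "'a::euclidean_space set \<Rightarrow> bool" where
  "boundary_class_C S \<longleftrightarrow>
     (\<forall>y\<in>frontier S. \<exists>V e g. y \<in> V \<and> graph_chart S V e g \<and> Ck 0 g)"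

definition boundary_C1_at :: "'a::euclidean_space set \<Rightarrow> 'a \<Rightarrow> bool" where
  "boundary_C1_at S y \<longleftrightarrow> (\<exists>V e g. y \<in> V \<and> graph_chart S V e g \<and> Ck 1 g)"

definition regular_set :: "'a::euclidean_space set \<Rightarrow> bool" where
  "regular_set S \<longleftrightarrow> boundary_class_C S \<and>
     (AE y in surface_measure. y \<in> frontier S \<longrightarrow> boundary_C1_at S y)"

text \<open>\<open>D\<close> is the Dirichlet part of the boundary and \<open>frontier S - D\<close> the Neumann part.\<close>

definition regular_domain :: "'a::euclidean_space set \<Rightarrow> 'a set \<Rightarrow> bool" where
  "regular_domain S D \<longleftrightarrow>
     open S \<and> connected S \<and> S \<noteq> {} \<and> bounded S \<and>
     D \<subseteq> frontier S \<and> D \<in> sets surface_measure \<and>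
     emeasure surface_measure D > 0 \<and> emeasure surface_measure (frontier S - D) > 0 \<and>
     regular_set S"

text \<open>The outward normal of the subgraph \<open>x \<bullet> e < g (tangential e x)\<close> is the normalised
  gradient of \<open>\<lambda>x. x \<bullet> e - g (tangential e x)\<close>.\<close>

definition outward_normal :: "'a::euclidean_space set \<Rightarrow> 'a \<Rightarrow> 'a" where
  "outward_normal S y = (THE n. \<exists>V e g. y \<in> V \<and> y \<in> frontier S \<and> graph_chart S V e g \<and> Ck 1 g \<and>
     n = sgn (e - tangential e (grad g (tangential e y))))"

section \<open>Boundary values and Green's formula\<close>

text \<open>A weak gradient is determined on \<open>S\<close> only up to null sets, so its boundary value at
  \<open>y\<close> is understood as the limit of averages over \<open>S \<inter> ball y r\<close>; for a field
  continuous on \<open>S \<union> {y}\<close> this is the ordinary boundary value.\<close>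

definition boundary_value_at :: "'a::euclidean_space set \<Rightarrow> ('a \<Rightarrow> 'a) \<Rightarrow> 'a \<Rightarrow> bool" where
  "boundary_value_at S F y \<longleftrightarrow>
     ((\<lambda>r. (LINT x:(S \<inter> ball y r)|lebesgue. norm (F x - F y)) / measure lebesgue (S \<inter> ball y r))
        \<longlongrightarrow> 0) (at_right 0)"

definition weak_divergence_on :: "'a::euclidean_space set \<Rightarrow> ('a \<Rightarrow> 'a) \<Rightarrow> ('a \<Rightarrow> real) \<Rightarrow> bool" where
  "weak_divergence_on S F f \<longleftrightarrow> set_integrable lebesgue S F \<and> set_integrable lebesgue S f \<and>
     (\<forall>\<phi>\<in>Ccinf S. (LINT x:S|lebesgue. F x \<bullet> grad \<phi> x) = - (LINT x:S|lebesgue. f x * \<phi> x))"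

text \<open>Green's formula
    \<open>\<integral>\<^sub>S F \<bullet> \<nabla>\<phi> + \<integral>\<^sub>S \<phi> div F = \<integral>\<^sub>\<partial>\<^sub>S \<phi> (F \<bullet> \<nu>)\<close>
  for the vector field \<open>F\<close> (given on \<open>S\<close> together with its boundary values) and all test
  functions \<open>\<phi>\<close> in \<open>\<D>(S, D)\<close>; these vanish on \<open>D\<close>, so that only the Neumann part of
  the boundary contributes.\<close>

definition greens_formula :: "'a::euclidean_space set \<Rightarrow> 'a set \<Rightarrow> ('a \<Rightarrow> 'a) \<Rightarrow> bool" where
  "greens_formula S D F \<longleftrightarrow> (\<forall>f. weak_divergence_on S F f \<longrightarrow> (\<forall>\<phi>\<in>Ccinf (- D).
     set_integrable surface_measure (frontier S - D) (\<lambda>y. \<phi> y * (F y \<bullet> outward_normal S y)) \<and>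
     (LINT x:S|lebesgue. F x \<bullet> grad \<phi> x) + (LINT x:S|lebesgue. \<phi> x * f x)
       = (LINT y:(frontier S - D)|surface_measure. \<phi> y * (F y \<bullet> outward_normal S y))))"

definition p_flux :: "real \<Rightarrow> 'a::euclidean_space \<Rightarrow> 'a" where
  "p_flux p v = norm v powr (p - 2) *\<^sub>R v"

end

theory Submission
  imports Defs
begin

text \<open>Picone's identity: for \<open>\<zeta>\<close> vanishing near the Dirichlet part, the test function
  \<open>\<phi> = \<bar>\<zeta>\<bar>\<^sup>p / (u + \<epsilon>) powr (p - 1)\<close> satisfies \<open>p_flux p (\<nabla>u) \<bullet> \<nabla>\<phi> \<le> \<bar>\<nabla>\<zeta>\<bar>\<^sup>p\<close> by Young's
  inequality.  Green's formula and the sign of the normal derivative make \<open>u\<close> a weak supersolution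
  with respect to nonnegative test functions on \<open>\<Omega>\<close>, and \<open>\<epsilon> \<rightarrow> 0\<close> gives
  \<open>R \<integral>\<bar>\<zeta>\<bar>\<^sup>p \<le> \<integral>\<bar>\<nabla>\<zeta>\<bar>\<^sup>p\<close>, where \<open>R\<close> is the Rayleigh quotient of \<open>u\<close> on \<open>\<Upsilon>\<close>.  Green's formula
  is only available for smooth test functions, so \<open>u\<close> in the denominator is replaced by test
  functions \<open>z n \<longlonglongrightarrow> u\<close>, which exist because \<open>u\<close> lies in the closure of \<open>\<D>(\<Upsilon>, \<partial>\<Upsilon>\<^sub>D)\<close>, and absolute
  values by smooth approximations.\<close>

section \<open>Smooth functions and test functions\<close>

text \<open>The equation for \<open>u\<close> is not assumed: it is derived from minimality by
  perturbing with test functions, and it identifies the weak divergence that Green's formula asks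
  for. The obstacle is that the flux contains the weak gradient \<open>Du\<close>, while a smooth
  test function can only contain \<open>grad (z n)\<close>, so Picone's cancellation is inexact. The
  defect consists of \<open>norm (Du x - grad (z n) x)\<close> paired with a power of
  \<open>norm (Du x)\<close>, and of a term dominated by a multiple of
  \<open>norm (Du x) powr p\<close> that tends to 0 almost everywhere on \<Omega> because
  \<open>u\<close> is positive there. The functions \<open>z n\<close> may vanish or change sign
  even where \<open>u\<close> is positive. Hence the smoothed absolute value, and the shift
  \<epsilon>, which bounds the denominator from below uniformly in \<open>n\<close>. The smoothing
  parameter tends to 0 along with the approximation while \<epsilon> is fixed; \<epsilon> tends to 0
  last.\<close>

lemma has_derivative_grad:
  assumes "f differentiable (at x)"
  shows "(f has_derivative (\<lambda>h. grad f x \<bullet> h)) (at x)"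
proof -
  let ?F = "frechet_derivative f (at x)"
  have D: "(f has_derivative ?F) (at x)"
    using assms by (simp add: frechet_derivative_works)
  then have lin: "linear ?F" by (rule has_derivative_linear)
  have "?F h = grad f x \<bullet> h" for h
  proof -
    have "?F h = ?F (\<Sum>b\<in>Basis. (h \<bullet> b) *\<^sub>R b)" by (simp add: euclidean_representation)
    also have "\<dots> = (\<Sum>b\<in>Basis. (h \<bullet> b) * ?F b)"
      by (simp add: linear_sum[OF lin] linear_cmul[OF lin])
    also have "\<dots> = grad f x \<bullet> h"
      by (simp add: grad_def inner_sum_right inner_commute[of _ h] mult.commute)
    finally show ?thesis .
  qed
  then have "?F = (\<lambda>h. grad f x \<bullet> h)" by (rule ext)
  with D show ?thesis by (rule subst[rotated])
qed

lemma grad_eqI: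
  assumes "(f has_derivative (\<lambda>h. d \<bullet> h)) (at x)"
  shows "grad f x = d"
proof -
  have "frechet_derivative f (at x) = (\<lambda>h. d \<bullet> h)"
    using assms by (rule frechet_derivative_at[symmetric])
  then show ?thesis by (simp add: grad_def euclidean_representation)
qed

text \<open>Lets the inductions below work with an explicit gradient field \<open>D\<close>;
  uniqueness of the derivative identifies it with \<open>grad f\<close>.\<close>

lemma Ck_SucI:
  assumes "\<And>x. (f has_derivative (\<lambda>h. D x \<bullet> h)) (at x)"
    and "\<And>b. b \<in> Basis \<Longrightarrow> Ck k (\<lambda>x. D x \<bullet> b)"
  shows "Ck (Suc k) f"
proof -
  have "grad f x = D x" for x using assms(1) by (rule grad_eqI)
  then show ?thesis using assms by (auto simp: differentiable_def)
qed

lemma Ck_Suc_has_derivative: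
  "Ck (Suc k) f \<Longrightarrow> (f has_derivative (\<lambda>h. grad f x \<bullet> h)) (at x)"
  by (simp add: has_derivative_grad)

lemma Ck_SucD: "Ck (Suc k) f \<Longrightarrow> Ck k f"
proof (induction k arbitrary: f)
  case 0
  then show ?case
    by (auto intro!: continuous_at_imp_continuous_on differentiable_imp_continuous_within)
next
  case (Suc k)
  then show ?case by auto
qed

lemma Ck_const: "Ck k (\<lambda>x. c)"
proof (induction k arbitrary: c)
  case (Suc k)
  have "((\<lambda>x. c) has_derivative (\<lambda>h. 0 \<bullet> h)) (at x)" for x :: 'a by simp
  then show ?case by (rule Ck_SucI) (simp add: Suc)
qed simp

lemma Ck_add: "Ck k f \<Longrightarrow> Ck k g \<Longrightarrow> Ck k (\<lambda>x. f x + g x)"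
proof (induction k arbitrary: f g)
  case 0
  then show ?case by (auto intro: continuous_intros)
next
  case (Suc k)
  have "((\<lambda>x. f x + g x) has_derivative (\<lambda>h. (grad f x + grad g x) \<bullet> h)) (at x)" for x
    using Suc.prems[THEN Ck_Suc_has_derivative, of x]
    by (auto simp: inner_add_left intro!: derivative_eq_intros)
  then show ?case
    using Suc by (intro Ck_SucI[where D = "\<lambda>x. grad f x + grad g x"]) (auto simp: inner_add_left)
qed

lemma Ck_mult: "Ck k f \<Longrightarrow> Ck k g \<Longrightarrow> Ck k (\<lambda>x. f x * g x)"
proof (induction k arbitrary: f g)
  case 0
  then show ?case by (auto intro: continuous_intros)
next
  case (Suc k)
  have D: "((\<lambda>x. f x * g x) has_derivative (\<lambda>h. (f x *\<^sub>R grad g x + g x *\<^sub>R grad f x) \<bullet> h)) (at x)" for x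
    by (rule has_derivative_eq_rhs[OF has_derivative_mult[OF Suc.prems[THEN Ck_Suc_has_derivative, of x]]])
      (auto simp: inner_add_left mult.commute)
  have "Ck k (\<lambda>x. (f x *\<^sub>R grad g x + g x *\<^sub>R grad f x) \<bullet> b)" if "b \<in> Basis" for b
    using Suc.IH[of f "\<lambda>x. grad g x \<bullet> b"] Suc.IH[of g "\<lambda>x. grad f x \<bullet> b"] Suc.prems
      Ck_SucD[OF Suc.prems(1)] Ck_SucD[OF Suc.prems(2)] that
    by (auto simp: inner_add_left intro!: Ck_add)
  with D show ?case by (rule Ck_SucI)
qed

lemma has_derivative_powr_grad:
  assumes "(f has_derivative (\<lambda>h. d \<bullet> h)) (at x)" "f x > (0::real)"
  shows "((\<lambda>x. f x powr a) has_derivative (\<lambda>h. ((a * f x powr (a - 1)) *\<^sub>R d) \<bullet> h)) (at x)"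
  by (rule has_derivative_eq_rhs[OF has_derivative_powr[OF assms(1) has_derivative_const assms(2)]])
    (use assms(2) in \<open>auto simp: powr_diff fun_eq_iff\<close>)

text \<open>Differentiation lowers the exponent by one, so the induction has to be over all
  exponents \<open>a\<close> at once; positivity of \<open>f\<close> keeps every such power
  smooth.\<close>

lemma Ck_powr: "Ck k f \<Longrightarrow> (\<And>x. f x > 0) \<Longrightarrow> Ck k (\<lambda>x. f x powr a)"
proof (induction k arbitrary: a)
  case 0
  then show ?case by (auto intro!: continuous_intros) (metis less_irrefl)
next
  case (Suc k)
  have D: "((\<lambda>x. f x powr a) has_derivative (\<lambda>h. ((a * f x powr (a - 1)) *\<^sub>R grad f x) \<bullet> h)) (at x)" for x
    by (intro has_derivative_powr_grad Ck_Suc_has_derivative[OF Suc.prems(1)] Suc.prems)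
  have "Ck k (\<lambda>x. f x powr (a - 1))" using Suc.IH Suc.prems by (blast intro: Ck_SucD)
  then have "Ck k (\<lambda>x. (a * f x powr (a - 1)) * (grad f x \<bullet> b))" if "b \<in> Basis" for b
    using Suc.prems that by (intro Ck_mult Ck_const) auto
  then show ?case by (intro Ck_SucI[OF D]) auto
qed

lemma Ck_affine: "Ck k f \<Longrightarrow> Ck k (\<lambda>x. f (c *\<^sub>R x + a))"
proof (induction k arbitrary: f)
  case 0
  then show ?case
    by (auto intro!: continuous_on_compose2[of UNIV f] continuous_intros)
next
  case (Suc k)
  have D: "((\<lambda>x. f (c *\<^sub>R x + a)) has_derivative (\<lambda>h. (c *\<^sub>R grad f (c *\<^sub>R x + a)) \<bullet> h)) (at x)" for x
  proof -
    have "((\<lambda>x. c *\<^sub>R x + a) has_derivative (\<lambda>h. c *\<^sub>R h)) (at x)"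
      by (auto intro!: derivative_eq_intros)
    from has_derivative_compose[OF this Ck_Suc_has_derivative[OF Suc.prems]]
    show ?thesis by simp
  qed
  have "Ck k (\<lambda>x. c * (grad f (c *\<^sub>R x + a) \<bullet> b))" if "b \<in> Basis" for b
    using Suc.IH[of "\<lambda>x. grad f x \<bullet> b"] Suc.prems that by (intro Ck_mult Ck_const) auto
  then show ?case by (intro Ck_SucI[OF D]) auto
qed

section \<open>Gradients and supports of test functions\<close>

lemma Cinf_has_derivative:
  "Cinf f \<Longrightarrow> (f has_derivative (\<lambda>h. grad f x \<bullet> h)) (at x)"
  unfolding Cinf_def using Ck_Suc_has_derivative by blast

lemma Cinf_continuous: "Cinf f \<Longrightarrow> continuous_on UNIV f"
  unfolding Cinf_def by (metis Ck.simps(1))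

lemma Cinf_continuous_grad:
  assumes "Cinf f" shows "continuous_on UNIV (grad f)"
proof -
  have "Ck (Suc 0) f" using assms unfolding Cinf_def by blast
  then have "\<And>b. b \<in> Basis \<Longrightarrow> continuous_on UNIV (\<lambda>x. grad f x \<bullet> b)" by simp
  then show ?thesis by (subst continuous_on_componentwise) auto
qed

lemma grad_add_scaled:
  assumes "Cinf f" "Cinf g"
  shows "grad (\<lambda>x. f x + t * g x) x = grad f x + t *\<^sub>R grad g x"
  by (intro grad_eqI)
    (use assms[THEN Cinf_has_derivative, of x] in \<open>auto simp: inner_add_left intro!: derivative_eq_intros\<close>)

lemma grad_mult:
  assumes "Cinf f" "Cinf g"
  shows "grad (\<lambda>x. f x * g x) x = f x *\<^sub>R grad g x + g x *\<^sub>R grad f x"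
  by (intro grad_eqI has_derivative_eq_rhs[OF has_derivative_mult[OF assms[THEN Cinf_has_derivative, of x]]])
    (auto simp: inner_add_left mult.commute)

lemma supp_subset: "(\<And>x. g x = 0 \<Longrightarrow> f x = 0) \<Longrightarrow> supp f \<subseteq> supp g"
  unfolding supp_def by (intro closure_mono) auto

lemma not_in_supp: "x \<notin> supp f \<Longrightarrow> f x = 0"
  using closure_subset[of "{x. f x \<noteq> 0}"] by (auto simp: supp_def)

text \<open>Since \<open>supp f\<close> is a closed subset of the compact set \<open>supp g\<close>,
  it suffices to compare zero sets. This is how nonlinear expressions in a test function are
  recognised as test functions.\<close>

lemma Ccinf_supp_mono:
  assumes "g \<in> Ccinf A" "Cinf f" "\<And>x. g x = 0 \<Longrightarrow> f x = 0"
  shows "f \<in> Ccinf A"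
proof -
  have "supp f \<subseteq> supp g" using assms(3) by (rule supp_subset)
  moreover have "closed (supp f)" by (simp add: supp_def)
  ultimately show ?thesis
    using assms(1,2) compact_Int_closed[of "supp g" "supp f"] by (auto simp: Ccinf_def Int_absorb1)
qed

lemma Ccinf_mono: "A \<subseteq> B \<Longrightarrow> Ccinf A \<subseteq> Ccinf B"
  by (auto simp: Ccinf_def)

lemma Ccinf_Cinf: "f \<in> Ccinf A \<Longrightarrow> Cinf f"
  by (simp add: Ccinf_def)

lemma Ccinf_add_scaled:
  assumes "f \<in> Ccinf A" "g \<in> Ccinf A"
  shows "(\<lambda>x. f x + t * g x) \<in> Ccinf A"
proof -
  have "Cinf (\<lambda>x. f x + t * g x)"
    using assms by (auto simp: Ccinf_def Cinf_def intro!: Ck_add Ck_mult Ck_const)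
  moreover have "supp (\<lambda>x. f x + t * g x) \<subseteq> supp f \<union> supp g"
    unfolding supp_def closure_Un[symmetric] by (intro closure_mono) auto
  moreover have "closed (supp (\<lambda>x. f x + t * g x))" by (simp add: supp_def)
  ultimately show ?thesis
    using assms compact_Int_closed[of "supp f \<union> supp g" "supp (\<lambda>x. f x + t * g x)"]
    by (auto simp: Ccinf_def Int_absorb1)
qed

lemma Ccinf_cmult: "f \<in> Ccinf A \<Longrightarrow> (\<lambda>x. c * f x) \<in> Ccinf A"
  by (rule Ccinf_supp_mono[where g = f]) (auto simp: Ccinf_def Cinf_def intro!: Ck_mult Ck_const)

lemma grad_eq_0_outside_supp:
  assumes "x \<notin> supp f" shows "grad f x = 0"
proof (rule grad_eqI)
  have "open (- supp f)" by (simp add: supp_def open_Compl)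
  have "((\<lambda>x. 0::real) has_derivative (\<lambda>h. 0 \<bullet> h)) (at x)" by simp
  then show "(f has_derivative (\<lambda>h. 0 \<bullet> h)) (at x)"
    by (rule has_derivative_transform_within_open[OF _ \<open>open (- supp f)\<close>])
      (use assms in \<open>auto simp: not_in_supp\<close>)
qed

lemma bounded_if_compact_supp:
  fixes g :: "'a::euclidean_space \<Rightarrow> 'b::euclidean_space"
  assumes "continuous_on UNIV g" "compact K" "\<And>x. x \<notin> K \<Longrightarrow> g x = 0"
  obtains B where "B \<ge> 0" "\<And>x. norm (g x) \<le> B"
proof -
  have "bounded (g ` K)"
    using assms by (intro compact_imp_bounded compact_continuous_image) (auto intro: continuous_on_subset)
  then obtain B where "B > 0" "\<And>x. x \<in> K \<Longrightarrow> norm (g x) \<le> B"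
    by (auto simp: bounded_pos)
  then have "B \<ge> 0" "norm (g x) \<le> B" for x
    using assms(3)[of x] by (cases "x \<in> K"; auto)+
  then show ?thesis by (rule that)
qed

lemma Ccinf_bounded:
  assumes "f \<in> Ccinf A"
  obtains B where "B \<ge> 0" "\<And>x. \<bar>f x\<bar> \<le> B"
proof (rule bounded_if_compact_supp[of f "supp f"])
  show "continuous_on UNIV f" "compact (supp f)"
    using assms by (auto simp: Ccinf_def Cinf_continuous)
qed (auto simp: not_in_supp that)

lemma Ccinf_grad_bounded:
  assumes "f \<in> Ccinf A"
  obtains B where "B \<ge> 0" "\<And>x. norm (grad f x) \<le> B"
proof (rule bounded_if_compact_supp[of "grad f" "supp f"])
  show "continuous_on UNIV (grad f)" "compact (supp f)"
    using assms by (auto simp: Ccinf_def Cinf_continuous_grad)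
qed (auto simp: grad_eq_0_outside_supp that)

section \<open>Convergence in \<open>L\<^sup>p\<close>\<close>

text \<open>Young's inequality for the conjugate exponents \<open>q\<close> and \<open>p\<close>,
  multiplied by \<open>p\<close>. The coefficient \<open>p - 1\<close> is the factor that appears
  when a power with exponent \<open>1 - p\<close> is differentiated, which is what makes the terms
  in Picone's identity cancel.\<close>

lemma young_powr:
  fixes a b p :: real
  assumes "1 < p" "0 \<le> a" "0 \<le> b"
  shows "p * (a powr (p - 1) * b) \<le> (p - 1) * a powr p + b powr p"
proof -
  define q where "q = p / (p - 1)"
  have q: "q > 1" "1/q + 1/p = 1" "(p - 1) * q = p" using assms by (auto simp: q_def field_simps)
  have "a powr (p - 1) * b \<le> (a powr (p - 1)) powr q / q + b powr p / p"
    using Youngs_inequality[of q p "a powr (p - 1)" b] assms q by simp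
  then have "p * (a powr (p - 1) * b) \<le> p * ((a powr (p - 1)) powr q / q + b powr p / p)"
    using assms by simp
  also have "\<dots> = (p - 1) * a powr p + b powr p"
    using assms q(1) q(3) by (simp add: powr_powr distrib_left) (simp add: q_def)
  finally show ?thesis .
qed

text \<open>At \<open>a = 0\<close> both sides vanish because \<open>0 powr _\<close> is 0. For the
  same reason the identities for \<open>p_flux\<close> hold at the zero vector even when
  \<open>p < 2\<close>.\<close>

lemma powr_split: "0 \<le> a \<Longrightarrow> a powr (p - 1) * a = a powr p" for a p :: real
  by (cases "a = 0") (auto simp: powr_diff)

lemma norm_p_flux: "norm (p_flux p v) = norm v powr (p - 1)"
  unfolding p_flux_def using powr_split[of "norm v" "p - 1"] by simp

lemma p_flux_inner_self: "p_flux p v \<bullet> v = norm v powr p"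
proof -
  have "p_flux p v \<bullet> v = norm v powr (p - 2) * norm v * norm v"
    by (simp add: p_flux_def power2_norm_eq_inner[symmetric] power2_eq_square mult.assoc)
  also have "norm v powr (p - 2) * norm v = norm v powr (p - 1)"
    using powr_split[of "norm v" "p - 1"] by simp
  finally show ?thesis by (simp add: powr_split)
qed

text \<open>The tangent inequality for the convex function \<open>norm v powr p\<close>, whose
  gradient is \<open>p\<close> times \<open>p_flux p v\<close>. Cauchy-Schwarz and Young's
  inequality give it without differentiating at the origin.\<close>

lemma norm_powr_above_tangent:
  assumes "1 < p"
  shows "norm a powr p + p * (p_flux p a \<bullet> (b - a)) \<le> norm b powr p"
proof -
  have "p_flux p a \<bullet> b \<le> norm a powr (p - 1) * norm b"
    using norm_cauchy_schwarz[of "p_flux p a" b] by (simp add: norm_p_flux)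
  then have "p * (p_flux p a \<bullet> b) \<le> p * (norm a powr (p - 1) * norm b)"
    using assms by simp
  also have "\<dots> \<le> (p - 1) * norm a powr p + norm b powr p"
    using assms by (intro young_powr) auto
  finally show ?thesis
    by (simp add: inner_diff_right p_flux_inner_self algebra_simps)
qed

text \<open>For \<open>p < 2\<close> the scalar factor blows up near the origin, but the norm of the
  flux is \<open>norm v powr (p - 1)\<close>, which tends to 0.\<close>

lemma isCont_p_flux:
  assumes "1 < p" shows "isCont (p_flux p) v"
proof (cases "v = 0")
  case True
  have "((\<lambda>x. norm (p_flux p x)) \<longlongrightarrow> 0) (at 0)"
    unfolding norm_p_flux using assms
    by (auto intro!: tendsto_zero_powrI[where b = "p - 1"] tendsto_norm_zero)
  then have "(p_flux p \<longlongrightarrow> 0) (at 0)" by (rule tendsto_norm_zero_cancel)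
  then show ?thesis using True by (simp add: isCont_def p_flux_def)
next
  case False
  then show ?thesis unfolding p_flux_def by (intro continuous_intros) auto
qed

lemma norm_add_powr_le:
  assumes "0 \<le> p"
  shows "norm (a + b) powr p \<le> 2 powr p * (norm a powr p + norm b powr p)"
proof -
  have "norm (a + b) powr p \<le> (2 * max (norm a) (norm b)) powr p"
    using norm_triangle_ineq[of a b] assms by (intro powr_mono2) auto
  also have "\<dots> = 2 powr p * max (norm a) (norm b) powr p"
    by (simp add: powr_mult)
  also have "max (norm a) (norm b) powr p \<le> norm a powr p + norm b powr p"
    by (auto simp: max_def)
  finally show ?thesis by simp
qed

section \<open>Functions with integrable \<open>p\<close>-th power and their limit theorems\<close>

definition in_Lp :: "'b measure \<Rightarrow> real \<Rightarrow> ('b \<Rightarrow> 'c::euclidean_space) \<Rightarrow> bool" where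
  "in_Lp M p f \<longleftrightarrow> f \<in> borel_measurable M \<and> integrable M (\<lambda>x. norm (f x) powr p)"

lemma in_Lp_measurable [measurable_dest]: "in_Lp M p f \<Longrightarrow> f \<in> borel_measurable M"
  by (simp add: in_Lp_def)

lemma in_Lp_integrable: "in_Lp M p f \<Longrightarrow> integrable M (\<lambda>x. norm (f x) powr p)"
  by (simp add: in_Lp_def)

lemma in_Lp_add:
  assumes "0 \<le> p" "in_Lp M p f" "in_Lp M p g"
  shows "in_Lp M p (\<lambda>x. f x + g x)"
proof -
  note [measurable] = in_Lp_measurable[OF assms(2)] in_Lp_measurable[OF assms(3)]
  have "integrable M (\<lambda>x. norm (f x + g x) powr p)"
  proof (rule Bochner_Integration.integrable_bound)
    show "integrable M (\<lambda>x. 2 powr p * (norm (f x) powr p + norm (g x) powr p))"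
      using assms by (auto simp: in_Lp_def)
    show "AE x in M. norm (norm (f x + g x) powr p) \<le> norm (2 powr p * (norm (f x) powr p + norm (g x) powr p))"
      using norm_add_powr_le[OF assms(1)] by auto
  qed measurable
  then show ?thesis by (simp add: in_Lp_def)
qed

lemma in_Lp_scaleR:
  assumes "in_Lp M p f" shows "in_Lp M p (\<lambda>x. c *\<^sub>R f x)"
  using assms by (auto simp: in_Lp_def powr_mult)

lemma in_Lp_diff:
  assumes "0 \<le> p" "in_Lp M p f" "in_Lp M p g"
  shows "in_Lp M p (\<lambda>x. f x - g x)"
  using in_Lp_add[OF assms(1,2) in_Lp_scaleR[OF assms(3), of "-1"]] by simp

lemma (in finite_measure) in_Lp_bounded:
  assumes "0 \<le> p" "f \<in> borel_measurable M" "\<And>x. norm (f x) \<le> B"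
  shows "in_Lp M p f"
proof -
  have "integrable M (\<lambda>x. norm (f x) powr p)"
    using assms by (intro integrable_const_bound[where B = "B powr p"]) (auto intro!: powr_mono2 AE_I2)
  with assms show ?thesis by (simp add: in_Lp_def)
qed

text \<open>The Hoelder pairing of a function to the power \<open>p - 1\<close> with a second one;
  Young's inequality supplies the integrable majorant.\<close>

lemma integrable_powr_mult:
  assumes "1 < p" "in_Lp M p f" "in_Lp M p g"
  shows "integrable M (\<lambda>x. norm (f x) powr (p - 1) * norm (g x))"
proof (rule Bochner_Integration.integrable_bound)
  note [measurable] = in_Lp_measurable[OF assms(2)] in_Lp_measurable[OF assms(3)]
  show "(\<lambda>x. norm (f x) powr (p - 1) * norm (g x)) \<in> borel_measurable M" by measurable
  show "integrable M (\<lambda>x. ((p - 1) * norm (f x) powr p + norm (g x) powr p) / p)"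
    using assms by (auto simp: in_Lp_def)
  have "norm (f x) powr (p - 1) * norm (g x) \<le> ((p - 1) * norm (f x) powr p + norm (g x) powr p) / p" for x
    using young_powr[of p "norm (f x)" "norm (g x)"] assms by (simp add: field_simps)
  then show "AE x in M. norm (norm (f x) powr (p - 1) * norm (g x))
      \<le> norm (((p - 1) * norm (f x) powr p + norm (g x) powr p) / p)"
    using assms(1) by auto
qed

lemma (in finite_measure) integrable_powr_minus_one:
  assumes "1 < p" "in_Lp M p f"
  shows "integrable M (\<lambda>x. norm (f x) powr (p - 1))"
  using integrable_powr_mult[OF assms in_Lp_bounded[of p "\<lambda>_. 1::real" 1]] assms by simp

lemma (in finite_measure) in_Lp_imp_integrable:
  assumes "1 < p" "in_Lp M p f"
  shows "integrable M f"
proof -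
  have "integrable M (\<lambda>x. norm (f x))"
    using integrable_powr_mult[OF assms(1) in_Lp_bounded[of p "\<lambda>_. 1::real" 1] assms(2)] assms by simp
  then show ?thesis
    using in_Lp_measurable[OF assms(2)] by (simp add: integrable_norm_iff)
qed

text \<open>A substitute for Hoelder's inequality: in Young's inequality the weight \<open>\<tau>\<close> on the
  fixed factor is free and is chosen small first.\<close>

lemma powr_mult_tendsto_0:
  assumes p: "1 < p" and f: "in_Lp M p f" and g: "\<And>n. in_Lp M p (g n)"
    and lim: "(\<lambda>n. \<integral>x. norm (g n x) powr p \<partial>M) \<longlonglongrightarrow> 0"
  shows "(\<lambda>n. \<integral>x. norm (f x) powr (p - 1) * norm (g n x) \<partial>M) \<longlonglongrightarrow> 0"
proof (rule LIMSEQ_I)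
  fix e :: real assume "e > 0"
  define K where "K = (\<integral>x. norm (f x) powr p \<partial>M)"
  have "K \<ge> 0" by (simp add: K_def)
  \<comment> \<open>Chosen so that the term with the fixed factor contributes at most
    \<open>e / 2\<close>, since \<open>\<tau> powr p * K \<le> e / 2\<close>; the summand 1 keeps
    the denominator positive when \<open>K = 0\<close>.\<close>
  define \<tau> where "\<tau> = (e / (2 * (K + 1))) powr (1 / p)"
  have \<tau>: "\<tau> > 0" "\<tau> powr p = e / (2 * (K + 1))"
    using \<open>e > 0\<close> \<open>K \<ge> 0\<close> p by (auto simp: \<tau>_def powr_powr)
  define C where "C = (\<tau> powr (1 - p)) powr p"
  have "C > 0" using \<tau> by (simp add: C_def)
  have "(\<lambda>n. C * (\<integral>x. norm (g n x) powr p \<partial>M)) \<longlonglongrightarrow> C * 0"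
    by (intro tendsto_intros lim)
  then have "eventually (\<lambda>n. C * (\<integral>x. norm (g n x) powr p \<partial>M) < e / 2) sequentially"
    using \<open>e > 0\<close> by (intro order_tendstoD) auto
  then obtain N where N: "\<And>n. n \<ge> N \<Longrightarrow> C * (\<integral>x. norm (g n x) powr p \<partial>M) < e / 2"
    by (auto simp: eventually_sequentially)
  have "(\<integral>x. norm (f x) powr (p - 1) * norm (g n x) \<partial>M) < e" if "n \<ge> N" for n
  proof -
    have le: "norm (f x) powr (p - 1) * norm (g n x) \<le> \<tau> powr p * norm (f x) powr p + C * norm (g n x) powr p" for x
    proof -
      \<comment> \<open>The weight \<tau> on \<open>f\<close> is compensated by
        \<open>\<tau> powr (1 - p)\<close> on \<open>g n\<close>, so the product is unchanged. The
        price is the possibly large constant \<open>C\<close> in front of the term that tends to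
        0.\<close>
      have eq: "(\<tau> * norm (f x)) powr (p - 1) * (\<tau> powr (1 - p) * norm (g n x))
          = norm (f x) powr (p - 1) * norm (g n x)"
        using \<tau>(1) by (simp add: powr_mult powr_diff)
      define Y Z where "Y = \<tau> powr p * norm (f x) powr p" and "Z = C * norm (g n x) powr p"
      have YZ: "(\<tau> * norm (f x)) powr p = Y" "(\<tau> powr (1 - p) * norm (g n x)) powr p = Z"
        using \<tau>(1) by (auto simp: powr_mult C_def Y_def Z_def)
      have "p * (norm (f x) powr (p - 1) * norm (g n x)) \<le> (p - 1) * Y + Z"
        using young_powr[of p "\<tau> * norm (f x)" "\<tau> powr (1 - p) * norm (g n x)"] \<tau>(1) p
        unfolding eq YZ by simp
      moreover have "0 \<le> Y" "0 \<le> (p - 1) * Z"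
        using p \<open>C > 0\<close> by (auto simp: Y_def Z_def)
      ultimately have "p * (norm (f x) powr (p - 1) * norm (g n x)) \<le> p * (Y + Z)"
        by (simp add: algebra_simps)
      then show ?thesis using p by (simp add: Y_def Z_def)
    qed
    have "(\<integral>x. norm (f x) powr (p - 1) * norm (g n x) \<partial>M)
        \<le> (\<integral>x. \<tau> powr p * norm (f x) powr p + C * norm (g n x) powr p \<partial>M)"
      using f g[of n] by (intro integral_mono integrable_powr_mult p le) (auto simp: in_Lp_def)
    also have "\<dots> = \<tau> powr p * K + C * (\<integral>x. norm (g n x) powr p \<partial>M)"
      using f g[of n] by (simp add: in_Lp_def K_def)
    also have "\<tau> powr p * K \<le> e / 2"
      using \<open>e > 0\<close> \<open>K \<ge> 0\<close> by (simp add: \<tau> field_simps)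
    finally show ?thesis using N[OF that] by simp
  qed
  moreover have "0 \<le> (\<integral>x. norm (f x) powr (p - 1) * norm (g n x) \<partial>M)" for n
    by simp
  ultimately show "\<exists>no. \<forall>n\<ge>no. norm ((\<integral>x. norm (f x) powr (p - 1) * norm (g n x) \<partial>M) - 0) < e"
    by (metis abs_of_nonneg diff_zero real_norm_def)
qed

text \<open>Two tangent inequalities squeeze the difference of the integrals: the tangent at
  \<open>f x\<close> gives the lower bound, the one at \<open>g n x\<close> the upper bound. In the
  latter, \<open>norm (g n x) powr (p - 1)\<close> is estimated through \<open>f x\<close> and the
  difference, so that only \<open>J n\<close> and \<open>I n\<close> remain.\<close>

lemma integral_powr_tendsto:
  assumes p: "1 < p" and f: "in_Lp M p f" and g: "\<And>n. in_Lp M p (g n)"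
    and lim: "(\<lambda>n. \<integral>x. norm (f x - g n x) powr p \<partial>M) \<longlonglongrightarrow> 0"
  shows "(\<lambda>n. \<integral>x. norm (g n x) powr p \<partial>M) \<longlonglongrightarrow> (\<integral>x. norm (f x) powr p \<partial>M)"
proof -
  define I J where "I n = (\<integral>x. norm (f x - g n x) powr p \<partial>M)"
    and "J n = (\<integral>x. norm (f x) powr (p - 1) * norm (f x - g n x) \<partial>M)" for n
  have d: "in_Lp M p (\<lambda>x. f x - g n x)" for n
    using p f g by (intro in_Lp_diff) auto
  have J: "J \<longlonglongrightarrow> 0"
    unfolding J_def by (rule powr_mult_tendsto_0[OF p f d lim])
  have I: "I \<longlonglongrightarrow> 0" using lim by (simp add: I_def[abs_def])
  have tangent: "norm a powr p - norm b powr p \<le> p * (norm a powr (p - 1) * norm (a - b))"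
    for a b :: 'b
  proof -
    have "p_flux p a \<bullet> (a - b) \<le> norm a powr (p - 1) * norm (a - b)"
      using norm_cauchy_schwarz[of "p_flux p a" "a - b"] by (simp add: norm_p_flux)
    then have "p * (p_flux p a \<bullet> (a - b)) \<le> p * (norm a powr (p - 1) * norm (a - b))"
      using p by simp
    moreover have "p * (p_flux p a \<bullet> (a - b)) = - (p * (p_flux p a \<bullet> (b - a)))"
      by (simp add: inner_diff_right algebra_simps)
    ultimately show ?thesis
      using norm_powr_above_tangent[OF p, of a b] by linarith
  qed
  have lower: "(\<integral>x. norm (f x) powr p \<partial>M) - p * J n \<le> (\<integral>x. norm (g n x) powr p \<partial>M)" for n
  proof -
    have "(\<integral>x. norm (f x) powr p - norm (g n x) powr p \<partial>M)
        \<le> (\<integral>x. p * (norm (f x) powr (p - 1) * norm (f x - g n x)) \<partial>M)"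
      using f g[of n] p integrable_powr_mult[OF p f d[of n]]
      by (intro integral_mono tangent) (auto simp: in_Lp_def)
    then show ?thesis using f g[of n] by (simp add: in_Lp_def J_def)
  qed
  \<comment> \<open>The factor \<open>p\<close> comes from the tangent inequality, the power of 2
    from splitting \<open>g n x\<close> into \<open>f x\<close> and \<open>g n x - f x\<close> under
    the exponent \<open>p - 1\<close>.\<close>
  define c where "c = p * 2 powr (p - 1)"
  have upper: "(\<integral>x. norm (g n x) powr p \<partial>M) \<le> (\<integral>x. norm (f x) powr p \<partial>M) + c * (J n + I n)" for n
  proof -
    have le: "norm (g n x) powr p - norm (f x) powr p
        \<le> c * (norm (f x) powr (p - 1) * norm (f x - g n x) + norm (f x - g n x) powr p)" for x
    proof -
      have "norm (g n x) powr (p - 1) \<le> 2 powr (p - 1) * (norm (f x) powr (p - 1) + norm (f x - g n x) powr (p - 1))"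
        using norm_add_powr_le[of "p - 1" "f x" "g n x - f x"] p by (simp add: norm_minus_commute)
      then have "norm (g n x) powr (p - 1) * norm (f x - g n x)
        \<le> 2 powr (p - 1) * (norm (f x) powr (p - 1) + norm (f x - g n x) powr (p - 1)) * norm (f x - g n x)"
        by (rule mult_right_mono) simp
      then have "p * (norm (g n x) powr (p - 1) * norm (f x - g n x))
        \<le> p * (2 powr (p - 1) * (norm (f x) powr (p - 1) + norm (f x - g n x) powr (p - 1)) * norm (f x - g n x))"
        using p by simp
      also have "\<dots> = c * (norm (f x) powr (p - 1) * norm (f x - g n x) + norm (f x - g n x) powr p)"
        by (simp add: c_def algebra_simps flip: powr_split[of "norm (f x - g n x)" p])
      finally show ?thesis
        using tangent[of "g n x" "f x"] by (simp add: norm_minus_commute)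
    qed
    have "(\<integral>x. norm (g n x) powr p - norm (f x) powr p \<partial>M)
        \<le> (\<integral>x. c * (norm (f x) powr (p - 1) * norm (f x - g n x) + norm (f x - g n x) powr p) \<partial>M)"
      using f g[of n] d[of n] p integrable_powr_mult[OF p f d[of n]]
      by (intro integral_mono le) (auto simp: in_Lp_def)
    then show ?thesis
      using f g[of n] d[of n] integrable_powr_mult[OF p f d[of n]] by (simp add: in_Lp_def J_def I_def)
  qed
  show ?thesis
  proof (rule tendsto_sandwich)
    show "(\<lambda>n. (\<integral>x. norm (f x) powr p \<partial>M) - p * J n) \<longlonglongrightarrow> (\<integral>x. norm (f x) powr p \<partial>M)"
      using tendsto_diff[OF tendsto_const tendsto_mult[OF tendsto_const J]] by simp
    show "(\<lambda>n. (\<integral>x. norm (f x) powr p \<partial>M) + c * (J n + I n)) \<longlonglongrightarrow> (\<integral>x. norm (f x) powr p \<partial>M)"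
      using tendsto_add[OF tendsto_const tendsto_mult[OF tendsto_const tendsto_add[OF J I]]] by simp
  qed (use lower upper in auto)
qed

text \<open>The subsequence theorem for convergence in the mean is applied to the
  \<open>p\<close>-th powers of the differences; pointwise \<open>p\<close>-th roots then give the
  claim.\<close>

lemma Lp_tendsto_AE_subseq:
  assumes p: "1 < p" and f: "in_Lp M p f" and g: "\<And>n. in_Lp M p (g n)"
    and lim: "(\<lambda>n. \<integral>x. norm (f x - g n x) powr p \<partial>M) \<longlonglongrightarrow> 0"
  shows "\<exists>r::nat\<Rightarrow>nat. strict_mono r \<and> (AE x in M. (\<lambda>n. g (r n) x) \<longlonglongrightarrow> f x)"
proof -
  have d: "in_Lp M p (\<lambda>x. f x - g n x)" for n
    using p f g by (intro in_Lp_diff) auto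
  have "\<exists>r::nat\<Rightarrow>nat. strict_mono r \<and> (AE x in M. (\<lambda>n. norm (f x - g (r n) x) powr p) \<longlonglongrightarrow> 0)"
    using in_Lp_integrable[OF d] lim by (intro tendsto_L1_AE_subseq) auto
  then obtain r where r: "strict_mono r" "AE x in M. (\<lambda>n. norm (f x - g (r n) x) powr p) \<longlonglongrightarrow> 0"
    by blast
  have "AE x in M. (\<lambda>n. g (r n) x) \<longlonglongrightarrow> f x"
    using r(2)
  proof eventually_elim
    case (elim x)
    have "(\<lambda>n. (norm (f x - g (r n) x) powr p) powr (1 / p)) \<longlonglongrightarrow> 0"
      using p by (intro tendsto_zero_powrI[OF elim tendsto_const]) auto
    then have "(\<lambda>n. norm (f x - g (r n) x)) \<longlonglongrightarrow> 0"
      using p by (simp add: powr_powr)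
    then have "(\<lambda>n. f x - (f x - g (r n) x)) \<longlonglongrightarrow> f x - 0"
      by (intro tendsto_intros tendsto_norm_zero_cancel[of "\<lambda>n. f x - g (r n) x"])
    then show ?case by simp
  qed
  with r(1) show ?thesis by blast
qed

section \<open>Lebesgue measure restricted to a set and to its subsets\<close>

lemma set_lebesgue_integral_lebesgue_on:
  fixes f :: "'a::euclidean_space \<Rightarrow> 'b::euclidean_space"
  assumes "S \<in> sets lebesgue"
  shows "(LINT x:S|lebesgue. f x) = integral\<^sup>L (lebesgue_on S) f"
  using assms by (simp add: set_lebesgue_integral_def integral_restrict_space)

lemma set_integrable_lebesgue_on:
  fixes f :: "'a::euclidean_space \<Rightarrow> 'b::euclidean_space"
  assumes "S \<in> sets lebesgue"
  shows "set_integrable lebesgue S f \<longleftrightarrow> integrable (lebesgue_on S) f"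
  using assms by (simp add: set_integrable_def integrable_restrict_space)

lemma Lp_on_iff_in_Lp:
  assumes "S \<in> sets lebesgue"
  shows "Lp_on S p f \<longleftrightarrow> in_Lp (lebesgue_on S) p f"
  using assms by (simp add: Lp_on_def in_Lp_def set_borel_measurable_def set_integrable_lebesgue_on
    borel_measurable_restrict_space_iff)

lemma integrable_lebesgue_on_subset:
  fixes f :: "'a::euclidean_space \<Rightarrow> 'b::euclidean_space"
  assumes "integrable (lebesgue_on T) f" "S \<in> sets lebesgue" "T \<in> sets lebesgue" "S \<subseteq> T"
  shows "integrable (lebesgue_on S) f"
  using assms set_integrable_subset[of lebesgue T f S] by (simp add: set_integrable_lebesgue_on)

lemma in_Lp_subset:
  assumes "in_Lp (lebesgue_on T) p f" "S \<in> sets lebesgue" "T \<in> sets lebesgue" "S \<subseteq> T"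
  shows "in_Lp (lebesgue_on S) p f"
proof -
  have "f \<in> borel_measurable (lebesgue_on S)"
    using measurable_restrict_mono[OF in_Lp_measurable[OF assms(1)] assms(4)] .
  then show ?thesis
    using integrable_lebesgue_on_subset[OF in_Lp_integrable[OF assms(1)] assms(2-4)]
    by (simp add: in_Lp_def)
qed

lemma integral_lebesgue_on_mono_set:
  fixes f :: "'a::euclidean_space \<Rightarrow> real"
  assumes "integrable (lebesgue_on T) f" "S \<in> sets lebesgue" "T \<in> sets lebesgue" "S \<subseteq> T" "\<And>x. f x \<ge> 0"
  shows "integral\<^sup>L (lebesgue_on S) f \<le> integral\<^sup>L (lebesgue_on T) f"
  using assms integrable_lebesgue_on_subset[OF assms(1-4)]
  by (simp add: integral_restrict_space integrable_restrict_space)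
    (intro integral_mono, auto simp: indicator_def)

lemma integral_lebesgue_on_eq_if_zero_outside:
  fixes f :: "'a::euclidean_space \<Rightarrow> real"
  assumes "S \<in> sets lebesgue" "T \<in> sets lebesgue" "S \<subseteq> T" "\<And>x. x \<in> T - S \<Longrightarrow> f x = 0"
  shows "integral\<^sup>L (lebesgue_on S) f = integral\<^sup>L (lebesgue_on T) f"
proof -
  have "(\<lambda>x. indicator S x *\<^sub>R f x) = (\<lambda>x. indicator T x *\<^sub>R f x)"
    using assms by (auto simp: indicator_def fun_eq_iff)
  then show ?thesis using assms by (simp add: integral_restrict_space)
qed

lemma finite_measure_lebesgue_on_bounded:
  assumes "bounded S" "S \<in> sets lebesgue"
  shows "finite_measure (lebesgue_on S)"
  using bounded_set_imp_lmeasurable[OF assms]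
  by (intro finite_measureI) (auto simp: emeasure_restrict_space space_restrict_space fmeasurable_def assms)

lemma continuous_imp_measurable_lebesgue_on:
  fixes f :: "'a::euclidean_space \<Rightarrow> 'b::euclidean_space"
  assumes "continuous_on UNIV f"
  shows "f \<in> borel_measurable (lebesgue_on S)"
proof -
  have "f \<in> borel_measurable lborel"
    using borel_measurable_continuous_onI[OF assms] by simp
  then show ?thesis by (intro measurable_restrict_space1 measurable_completion)
qed

section \<open>The Euler-Lagrange equation\<close>

lemma integrable_mult_bounded:
  fixes f g :: "'b \<Rightarrow> real"
  assumes "integrable M f" "g \<in> borel_measurable M" "\<And>x. \<bar>g x\<bar> \<le> B"
  shows "integrable M (\<lambda>x. f x * g x)"
proof (rule Bochner_Integration.integrable_bound)
  show "integrable M (\<lambda>x. B * f x)" using assms by simp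
  show "(\<lambda>x. f x * g x) \<in> borel_measurable M" using assms by measurable
  have "B \<ge> 0" using assms(3)[of undefined] by (smt (verit))
  then have "norm (f x * g x) \<le> norm (B * f x)" for x
    using mult_right_mono[OF assms(3)[of x], of "\<bar>f x\<bar>"] by (simp add: abs_mult mult.commute)
  then show "AE x in M. norm (f x * g x) \<le> norm (B * f x)" by simp
qed

lemma integrable_compact_supp:
  fixes g :: "'a::euclidean_space \<Rightarrow> real"
  assumes "continuous_on UNIV g" "compact K" "\<And>x. x \<notin> K \<Longrightarrow> g x = 0"
  shows "integrable lborel g"
proof -
  have "integrable lborel (\<lambda>x. indicator K x *\<^sub>R g x)"
    using assms by (intro borel_integrable_compact) (auto intro: continuous_on_subset)
  moreover have "(\<lambda>x. indicator K x *\<^sub>R g x) = g"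
    using assms(3) by (auto simp: indicator_def fun_eq_iff)
  ultimately show ?thesis by simp
qed

lemma lborel_integral_translation:
  fixes f :: "'a::euclidean_space \<Rightarrow> real"
  assumes "f \<in> borel_measurable borel"
  shows "(\<integral>x. f (c + x) \<partial>lborel) = (\<integral>x. f x \<partial>lborel)"
proof -
  have "(\<integral>x. f x \<partial>distr lborel borel ((+) c)) = (\<integral>x. f (c + x) \<partial>lborel)"
    using assms by (intro integral_distr) auto
  then show ?thesis by (simp add: lborel_distr_plus)
qed

section \<open>Integration by parts for smooth functions\<close>

text \<open>The integral of a derivative of a test function is a limit of integrals of difference
  quotients, which vanish because the Lebesgue measure is translation invariant.\<close>

lemma integral_grad_Ccinf:
  fixes f :: "'a::euclidean_space \<Rightarrow> real"
  assumes f: "f \<in> Ccinf A"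
  shows "(\<integral>x. grad f x \<bullet> b \<partial>lborel) = 0"
proof -
  have cf: "Cinf f" "compact (supp f)" using f by (auto simp: Ccinf_def)
  note contf = Cinf_continuous[OF cf(1)]
  note contg = Cinf_continuous_grad[OF cf(1)]
  obtain B where B: "B \<ge> 0" "\<And>x. norm (grad f x) \<le> B" using Ccinf_grad_bounded[OF f] by blast
  obtain r where r: "\<And>x. x \<in> supp f \<Longrightarrow> norm x \<le> r"
    using compact_imp_bounded[OF cf(2)] by (auto simp: bounded_iff)
  define t where "t n = 1 / real (Suc n)" for n
  have t: "t n > 0" "t n \<le> 1" for n by (auto simp: t_def)
  have t0: "t \<longlonglongrightarrow> 0" unfolding t_def[abs_def] by (rule LIMSEQ_Suc[OF lim_1_over_n])
  define s where "s n x = (f (t n *\<^sub>R b + x) - f x) / t n" for n x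
  have intf: "integrable lborel f"
    by (rule integrable_compact_supp[OF contf cf(2)]) (rule not_in_supp)
  have meas: "f \<in> borel_measurable borel"
    using contf by (rule borel_measurable_continuous_onI)
  have "integrable lborel (\<lambda>x. f (c + x))" for c
  proof -
    have "integrable (distr lborel borel ((+) c)) f" using intf by (simp add: lborel_distr_plus)
    then show ?thesis by (subst (asm) integrable_distr_eq) (use meas in auto)
  qed
  then have s0: "integral\<^sup>L lborel (s n) = 0" for n
    unfolding s_def using intf lborel_integral_translation[OF meas] by simp
  have lip: "\<bar>f x - f y\<bar> \<le> B * norm (x - y)" for x y
  proof -
    have "norm (f x - f y) \<le> B * norm (x - y)"
    proof (rule differentiable_bound[where S = UNIV])
      show "(f has_derivative (\<lambda>h. grad f x \<bullet> h)) (at x within UNIV)" for x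
        using Cinf_has_derivative[OF cf(1)] by simp
      show "onorm ((\<bullet>) (grad f x)) \<le> B" for x
      proof (rule onorm_le)
        show "norm (grad f x \<bullet> h) \<le> B * norm h" for h
          using Cauchy_Schwarz_ineq2[of "grad f x" h] mult_right_mono[OF B(2)[of x], of "norm h"]
          by simp
      qed
    qed auto
    then show ?thesis by simp
  qed
  \<comment> \<open>A majorant independent of \<open>n\<close>: the Lipschitz constant
    \<open>B\<close> bounds the quotients, and since \<open>t n \<le> 1\<close> a point outside the
    ball of radius \<open>r + norm b\<close> stays outside the support after the shift.\<close>
  have bound: "norm (s n x) \<le> B * norm b * indicator (cball 0 (r + norm b)) x" for n x
  proof (cases "x \<in> cball 0 (r + norm b)")
    case True
    have "\<bar>f (t n *\<^sub>R b + x) - f x\<bar> \<le> B * (t n * norm b)"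
      using lip[of "t n *\<^sub>R b + x" x] t(1)[of n] by simp
    then have "\<bar>f (t n *\<^sub>R b + x) - f x\<bar> / t n \<le> B * norm b"
      using t(1)[of n] by (simp add: field_simps)
    then show ?thesis using True t(1)[of n] by (simp add: s_def)
  next
    case False
    have "x \<notin> supp f" using False r[of x] by (auto intro: order_trans)
    moreover have "t n *\<^sub>R b + x \<notin> supp f"
    proof
      assume "t n *\<^sub>R b + x \<in> supp f"
      then have "norm (t n *\<^sub>R b + x) \<le> r" by (rule r)
      moreover have "norm x \<le> norm (t n *\<^sub>R b + x) + norm (t n *\<^sub>R b)"
        using norm_triangle_ineq4[of "t n *\<^sub>R b + x" "t n *\<^sub>R b"] by simp
      moreover have "norm (t n *\<^sub>R b) \<le> norm b"
        using t[of n] by (simp add: mult_left_le_one_le)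
      ultimately show False using False by simp
    qed
    ultimately have "s n x = 0" by (simp add: s_def not_in_supp)
    then show ?thesis using False by simp
  qed
  have lims: "(\<lambda>n. s n x) \<longlonglongrightarrow> grad f x \<bullet> b" for x
  proof -
    have "((\<lambda>\<tau>. f (\<tau> *\<^sub>R b + x)) has_derivative (\<lambda>h. grad f x \<bullet> (h *\<^sub>R b))) (at 0)"
    proof -
      have "((\<lambda>\<tau>. \<tau> *\<^sub>R b + x) has_derivative (\<lambda>h. h *\<^sub>R b)) (at 0)"
        by (auto intro!: derivative_eq_intros)
      from has_derivative_compose[OF this, of f "\<lambda>h. grad f x \<bullet> h"] show ?thesis
        using Cinf_has_derivative[OF cf(1), of x] by simp
    qed
    then have "((\<lambda>\<tau>. f (\<tau> *\<^sub>R b + x)) has_real_derivative (grad f x \<bullet> b)) (at 0)"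
      by (rule has_derivative_imp_has_field_derivative) (simp add: mult.commute)
    then have "((\<lambda>\<tau>. (f (\<tau> *\<^sub>R b + x) - f x) / \<tau>) \<longlongrightarrow> grad f x \<bullet> b) (at 0)"
      by (simp add: DERIV_def)
    then have "((\<lambda>n. (f (t n *\<^sub>R b + x) - f x) / t n) \<longlongrightarrow> grad f x \<bullet> b) sequentially"
      by (rule filterlim_compose)
        (use t0 less_imp_neq[OF t(1)] in \<open>auto simp: filterlim_at intro!: always_eventually\<close>)
    then show ?thesis by (simp add: s_def)
  qed
  have "(\<lambda>n. integral\<^sup>L lborel (s n)) \<longlonglongrightarrow> (\<integral>x. grad f x \<bullet> b \<partial>lborel)"
  proof (rule integral_dominated_convergence)
    show "integrable lborel (\<lambda>x::'a. B * norm b * indicator (cball 0 (r + norm b)) x :: real)"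
      by (intro integrable_mult_right integrable_real_indicator)
        (use emeasure_lborel_cball_finite[of "0::'a" "r + norm b"] in \<open>auto simp: less_top\<close>)
    have "continuous_on UNIV (\<lambda>x. grad f x \<bullet> b)" using contg by (intro continuous_intros)
    then show "(\<lambda>x. grad f x \<bullet> b) \<in> borel_measurable lborel"
      by (simp add: borel_measurable_continuous_onI)
    have "continuous_on UNIV (s n)" for n
      unfolding s_def using t(1)[of n]
      by (intro continuous_intros continuous_on_compose2[OF contf]) auto
    then show "s n \<in> borel_measurable lborel" for n
      by (simp add: borel_measurable_continuous_onI)
  qed (use lims bound in auto)
  then show ?thesis using s0 by (simp add: LIMSEQ_const_iff)
qed

text \<open>The product of \<phi> with a test function \<psi> on \<open>S\<close> is again a test
  function on \<open>S\<close>, so the integral of its derivative vanishes; the product rule splits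
  this into the two sides of the claim.\<close>

lemma weak_gradient_on_smooth:
  fixes S :: "'a::euclidean_space set"
  assumes \<phi>: "Cinf \<phi>" and S: "S \<in> sets lebesgue"
  shows "weak_gradient_on S \<phi> (grad \<phi>)"
  unfolding weak_gradient_on_def
proof (intro ballI)
  fix \<psi> :: "'a \<Rightarrow> real" and b :: 'a
  assume \<psi>: "\<psi> \<in> Ccinf S"
  then have cs: "Cinf \<psi>" "compact (supp \<psi>)" "supp \<psi> \<subseteq> S" by (auto simp: Ccinf_def)
  have "(\<lambda>x. \<phi> x * \<psi> x) \<in> Ccinf S"
    using \<phi> cs(1) by (intro Ccinf_supp_mono[OF \<psi>]) (auto simp: Cinf_def intro: Ck_mult)
  then have "(\<integral>x. grad (\<lambda>x. \<phi> x * \<psi> x) x \<bullet> b \<partial>lborel) = 0"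
    by (rule integral_grad_Ccinf)
  then have "(\<integral>x. \<phi> x * (grad \<psi> x \<bullet> b) + (grad \<phi> x \<bullet> b) * \<psi> x \<partial>lborel) = 0"
    by (simp add: grad_mult[OF \<phi> cs(1)] inner_add_left mult.commute)
  moreover
  have c1: "continuous_on UNIV (\<lambda>x. \<phi> x * (grad \<psi> x \<bullet> b))"
    using \<phi> cs(1) by (intro continuous_intros Cinf_continuous Cinf_continuous_grad)
  have c2: "continuous_on UNIV (\<lambda>x. (grad \<phi> x \<bullet> b) * \<psi> x)"
    using \<phi> cs(1) by (intro continuous_intros Cinf_continuous Cinf_continuous_grad)
  have "integrable lborel (\<lambda>x. \<phi> x * (grad \<psi> x \<bullet> b))"
    by (rule integrable_compact_supp[OF c1 cs(2)]) (simp add: grad_eq_0_outside_supp)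
  moreover have "integrable lborel (\<lambda>x. (grad \<phi> x \<bullet> b) * \<psi> x)"
    by (rule integrable_compact_supp[OF c2 cs(2)]) (simp add: not_in_supp)
  ultimately have sum0:
    "(\<integral>x. \<phi> x * (grad \<psi> x \<bullet> b) \<partial>lborel) + (\<integral>x. (grad \<phi> x \<bullet> b) * \<psi> x \<partial>lborel) = 0"
    by simp
  \<comment> \<open>Both integrands live on the support of \<psi>, which lies in \<open>S\<close>,
    so integration over \<open>S\<close> and over the whole space agree; continuity permits
    replacing \<open>lebesgue\<close> by \<open>lborel\<close>.\<close>
  have S_int: "(LINT x:S|lebesgue. g x) = (\<integral>x. g x \<partial>lborel)"
    if "continuous_on UNIV g" "\<And>x. x \<notin> supp \<psi> \<Longrightarrow> g x = 0" for g :: "'a \<Rightarrow> real"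
  proof -
    have "(\<lambda>x. indicator S x *\<^sub>R g x) = g"
      using that(2) cs(3) by (auto simp: indicator_def fun_eq_iff)
    then show ?thesis
      using borel_measurable_continuous_onI[OF that(1)]
      by (simp add: set_lebesgue_integral_def integral_completion)
  qed
  show "(LINT x:S|lebesgue. \<phi> x * (grad \<psi> x \<bullet> b)) = - (LINT x:S|lebesgue. (grad \<phi> x \<bullet> b) * \<psi> x)"
    using sum0 S_int[OF c1] S_int[OF c2] by (simp add: grad_eq_0_outside_supp not_in_supp)
qed

lemma weak_gradient_on_add_scaled:
  fixes S :: "'a::euclidean_space set"
  assumes "weak_gradient_on S u Du" "weak_gradient_on S v Dv"
    and S: "S \<in> sets lebesgue"
    and int: "integrable (lebesgue_on S) u" "integrable (lebesgue_on S) Du"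
      "integrable (lebesgue_on S) v" "integrable (lebesgue_on S) Dv"
  shows "weak_gradient_on S (\<lambda>x. u x + t * v x) (\<lambda>x. Du x + t *\<^sub>R Dv x)"
  unfolding weak_gradient_on_def
proof (intro ballI)
  fix \<psi> :: "'a \<Rightarrow> real" and b :: 'a
  assume \<psi>: "\<psi> \<in> Ccinf S" and b: "b \<in> Basis"
  obtain B where B: "\<And>x. \<bar>\<psi> x\<bar> \<le> B" using Ccinf_bounded[OF \<psi>] by blast
  obtain B' where "\<And>x. norm (grad \<psi> x) \<le> B'" using Ccinf_grad_bounded[OF \<psi>] by blast
  then have B': "\<bar>grad \<psi> x \<bullet> b\<bar> \<le> B'" for x
    using Basis_le_norm[OF b, of "grad \<psi> x"] by (rule order_trans[rotated])
  have m: "\<psi> \<in> borel_measurable (lebesgue_on S)"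
    "(\<lambda>x. grad \<psi> x \<bullet> b) \<in> borel_measurable (lebesgue_on S)"
    using Cinf_continuous[OF Ccinf_Cinf[OF \<psi>]] Cinf_continuous_grad[OF Ccinf_Cinf[OF \<psi>]]
    by (auto intro!: continuous_imp_measurable_lebesgue_on continuous_on_inner continuous_on_const)
  have i: "integrable (lebesgue_on S) (\<lambda>x. u x * (grad \<psi> x \<bullet> b))"
    "integrable (lebesgue_on S) (\<lambda>x. v x * (grad \<psi> x \<bullet> b))"
    "integrable (lebesgue_on S) (\<lambda>x. (Du x \<bullet> b) * \<psi> x)"
    "integrable (lebesgue_on S) (\<lambda>x. (Dv x \<bullet> b) * \<psi> x)"
    using int by (auto intro!: integrable_mult_bounded[OF _ m(2) B'] integrable_mult_bounded[OF _ m(1) B])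
  have *: "integral\<^sup>L (lebesgue_on S) (\<lambda>x. u x * (grad \<psi> x \<bullet> b)) = - integral\<^sup>L (lebesgue_on S) (\<lambda>x. (Du x \<bullet> b) * \<psi> x)"
     "integral\<^sup>L (lebesgue_on S) (\<lambda>x. v x * (grad \<psi> x \<bullet> b)) = - integral\<^sup>L (lebesgue_on S) (\<lambda>x. (Dv x \<bullet> b) * \<psi> x)"
    using assms(1,2) \<psi> b unfolding weak_gradient_on_def set_lebesgue_integral_lebesgue_on[OF S] by blast+
  show "(LINT x:S|lebesgue. (u x + t * v x) * (grad \<psi> x \<bullet> b)) = - (LINT x:S|lebesgue. ((Du x + t *\<^sub>R Dv x) \<bullet> b) * \<psi> x)"
    unfolding set_lebesgue_integral_lebesgue_on[OF S]
    using i * by (simp add: inner_add_left distrib_right mult.assoc)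
qed

section \<open>Sobolev functions perturbed by test functions\<close>

lemma Ccinf_in_Lp:
  fixes S :: "'a::euclidean_space set"
  assumes "\<phi> \<in> Ccinf A" "bounded S" "S \<in> sets lebesgue" "0 \<le> p"
  shows "in_Lp (lebesgue_on S) p \<phi>" "in_Lp (lebesgue_on S) p (grad \<phi>)"
proof -
  interpret finite_measure "lebesgue_on S"
    using assms by (intro finite_measure_lebesgue_on_bounded)
  obtain B where B: "\<And>x. \<bar>\<phi> x\<bar> \<le> B" using Ccinf_bounded[OF assms(1)] by blast
  then show "in_Lp (lebesgue_on S) p \<phi>"
    using assms Ccinf_Cinf by (intro in_Lp_bounded[where B = B] continuous_imp_measurable_lebesgue_on Cinf_continuous) auto
  obtain C where "\<And>x. norm (grad \<phi> x) \<le> C" using Ccinf_grad_bounded[OF assms(1)] by blast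
  then show "in_Lp (lebesgue_on S) p (grad \<phi>)"
    using assms Ccinf_Cinf by (intro in_Lp_bounded[where B = C] continuous_imp_measurable_lebesgue_on Cinf_continuous_grad) auto
qed

lemma W1p_D_in_Lp:
  assumes "W1p_D S D p u Du" "S \<in> sets lebesgue"
  shows "in_Lp (lebesgue_on S) p u" "in_Lp (lebesgue_on S) p Du"
  using assms by (auto simp: W1p_D_def W1p_def Lp_on_iff_in_Lp)

text \<open>Supplies the competitors for the first variation. Adding \<open>t * \<phi>\<close> to
  the approximating sequence of \<open>u\<close> leaves all differences unchanged, so the new
  sequence converges for the same reason.\<close>

lemma W1p_D_add_test_function:
  fixes S :: "'a::euclidean_space set"
  assumes u: "W1p_D S D p u Du" and \<phi>: "\<phi> \<in> Ccinf (- D)"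
    and S: "bounded S" "S \<in> sets lebesgue" and p: "1 < p"
  shows "W1p_D S D p (\<lambda>x. u x + t * \<phi> x) (\<lambda>x. Du x + t *\<^sub>R grad \<phi> x)"
proof -
  interpret finite_measure "lebesgue_on S"
    using S by (intro finite_measure_lebesgue_on_bounded)
  note Lu = W1p_D_in_Lp[OF u S(2)]
  have Lphi: "in_Lp (lebesgue_on S) p \<phi>" "in_Lp (lebesgue_on S) p (grad \<phi>)"
    using Ccinf_in_Lp[OF \<phi> S, of p] p by auto
  have 1: "Lp_on S p (\<lambda>x. u x + t * \<phi> x)" "Lp_on S p (\<lambda>x. Du x + t *\<^sub>R grad \<phi> x)"
    using in_Lp_add[OF _ Lu(1) in_Lp_scaleR[OF Lphi(1), of t]] in_Lp_add[OF _ Lu(2) in_Lp_scaleR[OF Lphi(2), of t]] p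
    by (auto simp: Lp_on_iff_in_Lp[OF S(2)])
  have 2: "weak_gradient_on S (\<lambda>x. u x + t * \<phi> x) (\<lambda>x. Du x + t *\<^sub>R grad \<phi> x)"
    using u S weak_gradient_on_smooth[OF Ccinf_Cinf[OF \<phi>] S(2)]
      Lu[THEN in_Lp_imp_integrable[OF p]] Lphi[THEN in_Lp_imp_integrable[OF p]]
    by (intro weak_gradient_on_add_scaled) (auto simp: W1p_D_def W1p_def)
  obtain \<zeta> where \<zeta>: "\<And>n. \<zeta> n \<in> Ccinf (- D)"
    "(\<lambda>n. (LINT x:S|lebesgue. \<bar>u x - \<zeta> n x\<bar> powr p)
          + (LINT x:S|lebesgue. norm (Du x - grad (\<zeta> n) x) powr p)) \<longlonglongrightarrow> 0"
    using u by (auto simp: W1p_D_def)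
  moreover from \<zeta>(1) have "grad (\<lambda>x. \<zeta> n x + t * \<phi> x) x = grad (\<zeta> n) x + t *\<^sub>R grad \<phi> x" for n x
    by (intro grad_add_scaled Ccinf_Cinf[OF \<phi>]) (rule Ccinf_Cinf)
  ultimately have "\<exists>\<zeta>. (\<forall>n. \<zeta> n \<in> Ccinf (- D)) \<and>
       (\<lambda>n. (LINT x:S|lebesgue. \<bar>u x + t * \<phi> x - \<zeta> n x\<bar> powr p)
          + (LINT x:S|lebesgue. norm (Du x + t *\<^sub>R grad \<phi> x - grad (\<zeta> n) x) powr p)) \<longlonglongrightarrow> 0"
    by (intro exI[of _ "\<lambda>n x. \<zeta> n x + t * \<phi> x"])
      (simp add: Ccinf_add_scaled \<phi>)
  with 1 2 show ?thesis by (simp add: W1p_D_def W1p_def)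
qed

lemma nontrivial_on_iff_integral_pos:
  fixes S :: "'a::euclidean_space set"
  assumes "in_Lp (lebesgue_on S) p u" "S \<in> sets lebesgue"
  shows "nontrivial_on S u \<longleftrightarrow> 0 < (\<integral>x. \<bar>u x\<bar> powr p \<partial>lebesgue_on S)"
proof -
  have "nontrivial_on S u \<longleftrightarrow> \<not> (AE x in lebesgue_on S. u x = 0)"
    using assms(2) by (simp add: nontrivial_on_def AE_restrict_space_iff)
  also have "\<dots> \<longleftrightarrow> (\<integral>x. \<bar>u x\<bar> powr p \<partial>lebesgue_on S) \<noteq> 0"
    using in_Lp_integrable[OF assms(1)] by (simp add: integral_nonneg_eq_0_iff_AE)
  also have "\<dots> \<longleftrightarrow> 0 < (\<integral>x. \<bar>u x\<bar> powr p \<partial>lebesgue_on S)"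
    by (metis (no_types, lifting) Bochner_Integration.integral_nonneg less_le powr_ge_zero)
  finally show ?thesis .
qed

lemma rayleigh_lebesgue_on:
  assumes "S \<in> sets lebesgue"
  shows "rayleigh S p u Du = (\<integral>x. norm (Du x) powr p \<partial>lebesgue_on S) / (\<integral>x. \<bar>u x\<bar> powr p \<partial>lebesgue_on S)"
  unfolding rayleigh_def set_lebesgue_integral_lebesgue_on[OF assms] ..

lemma rayleigh_nonneg:
  assumes "S \<in> sets lebesgue" shows "0 \<le> rayleigh S p u Du"
  unfolding rayleigh_lebesgue_on[OF assms] by simp

text \<open>In product form minimality holds for the trivial competitor too, so perturbations of
  \<open>u\<close> can be inserted without first showing that they are nontrivial.\<close>

lemma eigenfunction_le:
  fixes S :: "'a::euclidean_space set"
  assumes u: "fundamental_eigenfunction S D p u Du" and v: "W1p_D S D p v Dv"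
    and S: "S \<in> sets lebesgue"
  shows "rayleigh S p u Du * (\<integral>x. \<bar>v x\<bar> powr p \<partial>lebesgue_on S) \<le> (\<integral>x. norm (Dv x) powr p \<partial>lebesgue_on S)"
proof (cases "nontrivial_on S v")
  case True
  then have "0 < (\<integral>x. \<bar>v x\<bar> powr p \<partial>lebesgue_on S)"
    using nontrivial_on_iff_integral_pos[OF W1p_D_in_Lp(1)[OF v S] S] by simp
  moreover have "rayleigh S p u Du \<le> rayleigh S p v Dv"
    using u v True by (simp add: fundamental_eigenfunction_def)
  ultimately show ?thesis
    unfolding rayleigh_lebesgue_on[OF S, of p v] by (simp add: pos_le_divide_eq)
next
  case False
  then have "\<not> 0 < (\<integral>x. \<bar>v x\<bar> powr p \<partial>lebesgue_on S)"
    using nontrivial_on_iff_integral_pos[OF W1p_D_in_Lp(1)[OF v S] S] by simp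
  moreover have "0 \<le> (\<integral>x. \<bar>v x\<bar> powr p \<partial>lebesgue_on S)" by simp
  ultimately have "(\<integral>x. \<bar>v x\<bar> powr p \<partial>lebesgue_on S) = 0" by linarith
  then show ?thesis by simp
qed

lemma eigenfunction_eq:
  fixes S :: "'a::euclidean_space set"
  assumes u: "fundamental_eigenfunction S D p u Du" and S: "S \<in> sets lebesgue"
  shows "rayleigh S p u Du * (\<integral>x. \<bar>u x\<bar> powr p \<partial>lebesgue_on S) = (\<integral>x. norm (Du x) powr p \<partial>lebesgue_on S)"
proof -
  have "in_Lp (lebesgue_on S) p u" "nontrivial_on S u"
    using u W1p_D_in_Lp(1)[OF _ S] by (auto simp: fundamental_eigenfunction_def)
  then have "0 < (\<integral>x. \<bar>u x\<bar> powr p \<partial>lebesgue_on S)"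
    using nontrivial_on_iff_integral_pos[OF _ S] by blast
  then show ?thesis by (simp add: rayleigh_lebesgue_on[OF S])
qed

section \<open>First variation of the energy and the weak equation\<close>

lemma p_flux_measurable [measurable]: "p_flux p \<in> borel_measurable borel"
  unfolding p_flux_def by measurable

lemma abs_p_flux_inner_le: "\<bar>p_flux p v \<bullet> w\<bar> \<le> norm v powr (p - 1) * norm w"
  using Cauchy_Schwarz_ineq2[of "p_flux p v" w] by (simp add: norm_p_flux)

lemma integrable_p_flux_inner:
  assumes "1 < p" "in_Lp M p f" "in_Lp M p g"
  shows "integrable M (\<lambda>x. p_flux p (f x) \<bullet> g x)"
proof (rule Bochner_Integration.integrable_bound[OF integrable_powr_mult[OF assms]])
  note [measurable] = in_Lp_measurable[OF assms(2)] in_Lp_measurable[OF assms(3)]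
  show "(\<lambda>x. p_flux p (f x) \<bullet> g x) \<in> borel_measurable M" by measurable
  show "AE x in M. norm (p_flux p (f x) \<bullet> g x) \<le> norm (norm (f x) powr (p - 1) * norm (g x))"
    using abs_p_flux_inner_le by auto
qed

text \<open>Tangents at the far and at the near end of the segment bound the increment from above
  and from below. The upper bound serves for the gradient term, the lower one for the function term
  of the Rayleigh quotient.\<close>

lemma integral_p_flux_perturb:
  assumes p: "1 < p" and f: "in_Lp M p f" and g: "in_Lp M p g" and t: "0 < t"
  shows "(\<integral>x. norm (f x + t *\<^sub>R g x) powr p \<partial>M)
      \<le> (\<integral>x. norm (f x) powr p \<partial>M) + t * p * (\<integral>x. p_flux p (f x + t *\<^sub>R g x) \<bullet> g x \<partial>M)"
    and "(\<integral>x. norm (f x) powr p \<partial>M) + t * p * (\<integral>x. p_flux p (f x) \<bullet> g x \<partial>M)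
      \<le> (\<integral>x. norm (f x + t *\<^sub>R g x) powr p \<partial>M)"
proof -
  have h: "in_Lp M p (\<lambda>x. f x + t *\<^sub>R g x)"
    using in_Lp_add[OF _ f in_Lp_scaleR[OF g]] p by simp
  note int = in_Lp_integrable[OF f] in_Lp_integrable[OF h]
    integrable_p_flux_inner[OF p f g] integrable_p_flux_inner[OF p h g]
  have "norm (f x + t *\<^sub>R g x) powr p \<le> norm (f x) powr p + t * p * (p_flux p (f x + t *\<^sub>R g x) \<bullet> g x)" for x
    using norm_powr_above_tangent[OF p, of "f x + t *\<^sub>R g x" "f x"] by (simp add: algebra_simps)
  then have "(\<integral>x. norm (f x + t *\<^sub>R g x) powr p \<partial>M)
      \<le> (\<integral>x. norm (f x) powr p + t * p * (p_flux p (f x + t *\<^sub>R g x) \<bullet> g x) \<partial>M)"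
    using int by (intro integral_mono) auto
  then show "(\<integral>x. norm (f x + t *\<^sub>R g x) powr p \<partial>M)
      \<le> (\<integral>x. norm (f x) powr p \<partial>M) + t * p * (\<integral>x. p_flux p (f x + t *\<^sub>R g x) \<bullet> g x \<partial>M)"
    using int by simp
  have "norm (f x) powr p + t * p * (p_flux p (f x) \<bullet> g x) \<le> norm (f x + t *\<^sub>R g x) powr p" for x
    using norm_powr_above_tangent[OF p, of "f x" "f x + t *\<^sub>R g x"] by (simp add: algebra_simps)
  then have "(\<integral>x. norm (f x) powr p + t * p * (p_flux p (f x) \<bullet> g x) \<partial>M)
      \<le> (\<integral>x. norm (f x + t *\<^sub>R g x) powr p \<partial>M)"
    using int by (intro integral_mono) auto
  then show "(\<integral>x. norm (f x) powr p \<partial>M) + t * p * (\<integral>x. p_flux p (f x) \<bullet> g x \<partial>M)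
      \<le> (\<integral>x. norm (f x + t *\<^sub>R g x) powr p \<partial>M)"
    using int by simp
qed

text \<open>The flux is continuous, and \<open>t n \<le> 1\<close> gives a majorant that does not
  depend on \<open>n\<close>: the pairing of \<open>f\<close> with \<open>g\<close> plus the
  \<open>p\<close>-th power of \<open>g\<close>, up to a constant.\<close>

lemma integral_p_flux_tendsto:
  assumes p: "1 < p" and f: "in_Lp M p f" and g: "in_Lp M p g"
    and t: "t \<longlonglongrightarrow> 0" "\<And>n. 0 < t n" "\<And>n. t n \<le> 1"
  shows "(\<lambda>n. \<integral>x. p_flux p (f x + t n *\<^sub>R g x) \<bullet> g x \<partial>M) \<longlonglongrightarrow> (\<integral>x. p_flux p (f x) \<bullet> g x \<partial>M)"
proof (rule integral_dominated_convergence)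
  note [measurable] = in_Lp_measurable[OF f] in_Lp_measurable[OF g]
  show "(\<lambda>x. p_flux p (f x) \<bullet> g x) \<in> borel_measurable M"
    "\<And>n. (\<lambda>x. p_flux p (f x + t n *\<^sub>R g x) \<bullet> g x) \<in> borel_measurable M" by measurable
  show "integrable M (\<lambda>x. 2 powr (p - 1) * (norm (f x) powr (p - 1) * norm (g x) + norm (g x) powr p))"
    using integrable_powr_mult[OF p f g] in_Lp_integrable[OF g] by auto
  have "(\<lambda>n. p_flux p (f x + t n *\<^sub>R g x) \<bullet> g x) \<longlonglongrightarrow> p_flux p (f x + 0 *\<^sub>R g x) \<bullet> g x" for x
    by (intro tendsto_intros isCont_tendsto_compose[OF isCont_p_flux[OF p]] t(1))
  then show "AE x in M. (\<lambda>n. p_flux p (f x + t n *\<^sub>R g x) \<bullet> g x) \<longlonglongrightarrow> p_flux p (f x) \<bullet> g x"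
    by simp
  have "norm (p_flux p (f x + t n *\<^sub>R g x) \<bullet> g x)
      \<le> 2 powr (p - 1) * (norm (f x) powr (p - 1) * norm (g x) + norm (g x) powr p)" for n x
  proof -
    have "norm (f x + t n *\<^sub>R g x) powr (p - 1)
        \<le> 2 powr (p - 1) * (norm (f x) powr (p - 1) + norm (t n *\<^sub>R g x) powr (p - 1))"
      using p by (intro norm_add_powr_le) auto
    also have "norm (t n *\<^sub>R g x) powr (p - 1) \<le> norm (g x) powr (p - 1)"
      using p t(2,3)[of n] by (intro powr_mono2) (auto simp: mult_left_le_one_le)
    finally have "norm (f x + t n *\<^sub>R g x) powr (p - 1) * norm (g x)
        \<le> 2 powr (p - 1) * (norm (f x) powr (p - 1) + norm (g x) powr (p - 1)) * norm (g x)"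
      by (intro mult_right_mono) auto
    also have "\<dots> = 2 powr (p - 1) * (norm (f x) powr (p - 1) * norm (g x) + norm (g x) powr p)"
      by (simp add: algebra_simps flip: powr_split[of "norm (g x)" p])
    finally show ?thesis
      using abs_p_flux_inner_le[of p "f x + t n *\<^sub>R g x" "g x"] by simp
  qed
  then show "AE x in M. norm (p_flux p (f x + t n *\<^sub>R g x) \<bullet> g x)
      \<le> 2 powr (p - 1) * (norm (f x) powr (p - 1) * norm (g x) + norm (g x) powr p)" for n
    by simp
qed

text \<open>Minimality is applied to \<open>u + t * \<phi>\<close>, with the lower tangent bound on
  the function side and the upper one on the gradient side. This gives the one-sided inequality
  after division by \<open>t * p\<close> and passage to \<open>t = 0\<close>.\<close>

lemma eigenfunction_variation_le:
  fixes S :: "'a::euclidean_space set"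
  assumes u: "fundamental_eigenfunction S D p u Du" and \<phi>: "\<phi> \<in> Ccinf (- D)"
    and S: "bounded S" "S \<in> sets lebesgue" and p: "1 < p"
  shows "rayleigh S p u Du * (\<integral>x. p_flux p (u x) * \<phi> x \<partial>lebesgue_on S)
    \<le> (\<integral>x. p_flux p (Du x) \<bullet> grad \<phi> x \<partial>lebesgue_on S)"
proof -
  have W: "W1p_D S D p u Du" using u by (simp add: fundamental_eigenfunction_def)
  note Lu = W1p_D_in_Lp[OF W S(2)]
  have Lphi: "in_Lp (lebesgue_on S) p \<phi>" "in_Lp (lebesgue_on S) p (grad \<phi>)"
    using Ccinf_in_Lp[OF \<phi> S, of p] p by auto
  define R where "R = rayleigh S p u Du"
  have R: "R \<ge> 0" unfolding R_def by (rule rayleigh_nonneg[OF S(2)])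
  define t where "t n = 1 / real (Suc n)" for n
  have t: "t n > 0" "t n \<le> 1" for n by (auto simp: t_def)
  have t0: "t \<longlonglongrightarrow> 0" unfolding t_def[abs_def] by (rule LIMSEQ_Suc[OF lim_1_over_n])
  define E where "E = (\<integral>x. p_flux p (u x) * \<phi> x \<partial>lebesgue_on S)"
  define F where "F n = (\<integral>x. p_flux p (Du x + t n *\<^sub>R grad \<phi> x) \<bullet> grad \<phi> x \<partial>lebesgue_on S)" for n
  have "R * E \<le> F n" for n
  proof -
    have "(\<integral>x. \<bar>u x\<bar> powr p \<partial>lebesgue_on S) + t n * p * E \<le> (\<integral>x. \<bar>u x + t n * \<phi> x\<bar> powr p \<partial>lebesgue_on S)"
      using integral_p_flux_perturb(2)[OF p Lu(1) Lphi(1) t(1)[of n]] by (simp add: E_def)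
    then have "R * ((\<integral>x. \<bar>u x\<bar> powr p \<partial>lebesgue_on S) + t n * p * E) \<le> R * (\<integral>x. \<bar>u x + t n * \<phi> x\<bar> powr p \<partial>lebesgue_on S)"
      using R by (rule mult_left_mono)
    also have "\<dots> \<le> (\<integral>x. norm (Du x + t n *\<^sub>R grad \<phi> x) powr p \<partial>lebesgue_on S)"
      unfolding R_def by (intro eigenfunction_le[OF u W1p_D_add_test_function[OF W \<phi> S p] S(2)])
    also have "\<dots> \<le> (\<integral>x. norm (Du x) powr p \<partial>lebesgue_on S) + t n * p * F n"
      using integral_p_flux_perturb(1)[OF p Lu(2) Lphi(2) t(1)[of n]] by (simp add: F_def)
    \<comment> \<open>Equality for the eigenfunction itself lets the terms of order zero in
      \<open>t n\<close> cancel.\<close>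
    also have "(\<integral>x. norm (Du x) powr p \<partial>lebesgue_on S) = R * (\<integral>x. \<bar>u x\<bar> powr p \<partial>lebesgue_on S)"
      unfolding R_def by (rule eigenfunction_eq[OF u S(2), symmetric])
    finally have "(t n * p) * (R * E) \<le> (t n * p) * F n" by (simp add: algebra_simps)
    then show ?thesis using t(1)[of n] p by simp
  qed
  moreover have "F \<longlonglongrightarrow> (\<integral>x. p_flux p (Du x) \<bullet> grad \<phi> x \<partial>lebesgue_on S)"
    unfolding F_def by (intro integral_p_flux_tendsto p Lu Lphi t0 t)
  ultimately have "R * E \<le> (\<integral>x. p_flux p (Du x) \<bullet> grad \<phi> x \<partial>lebesgue_on S)"
    by (intro LIMSEQ_le_const) auto
  then show ?thesis by (simp add: R_def E_def)
qed

text \<open>The space of test functions is closed under negation, so the one-sided inequality for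
  \<phi> and for its negative yields equality.\<close>

lemma eigenfunction_weak_equation:
  fixes S :: "'a::euclidean_space set"
  assumes "fundamental_eigenfunction S D p u Du" and \<phi>: "\<phi> \<in> Ccinf (- D)"
    and "bounded S" "S \<in> sets lebesgue" and "1 < p"
  shows "(\<integral>x. p_flux p (Du x) \<bullet> grad \<phi> x \<partial>lebesgue_on S)
    = rayleigh S p u Du * (\<integral>x. p_flux p (u x) * \<phi> x \<partial>lebesgue_on S)"
proof -
  have "grad (\<lambda>x. - 1 * \<phi> x) x = - grad \<phi> x" for x
    by (intro grad_eqI)
      (use Cinf_has_derivative[OF Ccinf_Cinf[OF \<phi>], of x] in \<open>auto intro!: derivative_eq_intros\<close>)
  then show ?thesis
    using eigenfunction_variation_le[OF assms] eigenfunction_variation_le[OF assms(1) Ccinf_cmult[OF \<phi>, of "- 1"] assms(3-)]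
    by (simp add: mult_minus_left)
qed

text \<open>Provides the divergence required as input by \<open>greens_formula\<close>. Positivity
  on \<open>S\<close> turns \<open>p_flux p (u x)\<close> into
  \<open>u x powr (p - 1)\<close>.\<close>

lemma eigenfunction_weak_divergence:
  fixes S :: "'a::euclidean_space set"
  assumes u: "fundamental_eigenfunction T D p u Du"
    and T: "open T" "bounded T" "D \<subseteq> frontier T" and S: "open S" "S \<subseteq> T"
    and pos: "\<forall>x\<in>S. u x > 0" and p: "1 < p"
  shows "weak_divergence_on S (\<lambda>x. p_flux p (Du x)) (\<lambda>x. - (rayleigh T p u Du * u x powr (p - 1)))"
proof -
  have sets: "S \<in> sets lebesgue" "T \<in> sets lebesgue" using T S by auto
  have "bounded S" using T S bounded_subset by blast
  interpret finite_measure "lebesgue_on S"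
    using \<open>bounded S\<close> sets by (intro finite_measure_lebesgue_on_bounded)
  have W: "W1p_D T D p u Du" using u by (simp add: fundamental_eigenfunction_def)
  have Lu: "in_Lp (lebesgue_on S) p u" "in_Lp (lebesgue_on S) p Du"
    using W1p_D_in_Lp[OF W sets(2)] in_Lp_subset[OF _ sets S(2)] by auto
  define R where "R = rayleigh T p u Du"
  have u_powr: "x \<in> S \<Longrightarrow> \<bar>u x\<bar> powr (p - 1) = u x powr (p - 1)" for x using pos by (simp add: less_imp_le)
  have "integrable (lebesgue_on S) (\<lambda>x. p_flux p (Du x))"
  proof -
    have "integrable (lebesgue_on S) (\<lambda>x. norm (p_flux p (Du x)))"
      using integrable_powr_minus_one[OF p Lu(2)] by (simp add: norm_p_flux)
    then show ?thesis using in_Lp_measurable[OF Lu(2)] by (simp add: integrable_norm_iff)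
  qed
  moreover have "integrable (lebesgue_on S) (\<lambda>x. - (R * u x powr (p - 1)))"
  proof -
    have "integrable (lebesgue_on S) (\<lambda>x. u x powr (p - 1)) \<longleftrightarrow> integrable (lebesgue_on S) (\<lambda>x. norm (u x) powr (p - 1))"
      using u_powr by (intro Bochner_Integration.integrable_cong) (auto simp: space_restrict_space)
    then show ?thesis using integrable_powr_minus_one[OF p Lu(1)] by simp
  qed
  moreover have "(LINT x:S|lebesgue. p_flux p (Du x) \<bullet> grad \<phi> x) = - (LINT x:S|lebesgue. - (R * u x powr (p - 1)) * \<phi> x)"
    if \<phi>: "\<phi> \<in> Ccinf S" for \<phi>
  proof -
    have supp: "supp \<phi> \<subseteq> S" using \<phi> by (simp add: Ccinf_def)
    \<comment> \<open>An open set is disjoint from its frontier, so test functions supported in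
      \<open>S\<close> are admissible for the equation on the larger set \<open>T\<close>, and both
      integrands vanish on \<open>T - S\<close>.\<close>
    have "S \<subseteq> - D" using T S frontier_disjoint_eq[of T] by auto
    then have \<phi>': "\<phi> \<in> Ccinf (- D)" using \<phi> Ccinf_mono by blast
    have off: "\<phi> x = 0 \<and> grad \<phi> x = 0" if "x \<notin> S" for x
      using that supp not_in_supp[of x \<phi>] grad_eq_0_outside_supp[of x \<phi>] by blast
    have "(\<integral>x. p_flux p (Du x) \<bullet> grad \<phi> x \<partial>lebesgue_on S) = (\<integral>x. p_flux p (Du x) \<bullet> grad \<phi> x \<partial>lebesgue_on T)"
      by (intro integral_lebesgue_on_eq_if_zero_outside[OF sets S(2)]) (simp add: off)
    also have "\<dots> = R * (\<integral>x. p_flux p (u x) * \<phi> x \<partial>lebesgue_on T)"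
      unfolding R_def by (rule eigenfunction_weak_equation[OF u \<phi>' T(2) sets(2) p])
    also have "(\<integral>x. p_flux p (u x) * \<phi> x \<partial>lebesgue_on T) = (\<integral>x. p_flux p (u x) * \<phi> x \<partial>lebesgue_on S)"
      by (intro integral_lebesgue_on_eq_if_zero_outside[OF sets S(2), symmetric]) (simp add: off)
    also have "\<dots> = (\<integral>x. u x powr (p - 1) * \<phi> x \<partial>lebesgue_on S)"
      using pos powr_split[of _ "p - 1"]
      by (intro Bochner_Integration.integral_cong) (auto simp: space_restrict_space p_flux_def less_imp_le)
    finally show ?thesis
      unfolding set_lebesgue_integral_lebesgue_on[OF sets(1)] by (simp add: mult.assoc)
  qed
  ultimately show ?thesis
    by (simp add: weak_divergence_on_def set_integrable_lebesgue_on[OF sets(1)] R_def)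
qed

section \<open>The fundamental eigenvalue\<close>

lemma W1p_D_approx:
  fixes S :: "'a::euclidean_space set"
  assumes "W1p_D S D p u Du" and S: "S \<in> sets lebesgue"
  obtains z where "\<And>n. z n \<in> Ccinf (- D)"
    "(\<lambda>n. \<integral>x. norm (u x - z n x) powr p \<partial>lebesgue_on S) \<longlonglongrightarrow> 0"
    "(\<lambda>n. \<integral>x. norm (Du x - grad (z n) x) powr p \<partial>lebesgue_on S) \<longlonglongrightarrow> 0"
proof -
  obtain z where z: "\<And>n. z n \<in> Ccinf (- D)" and lim:
    "(\<lambda>n. (\<integral>x. norm (u x - z n x) powr p \<partial>lebesgue_on S)
        + (\<integral>x. norm (Du x - grad (z n) x) powr p \<partial>lebesgue_on S)) \<longlonglongrightarrow> 0"
    using assms by (auto simp: W1p_D_def set_lebesgue_integral_lebesgue_on)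
  show ?thesis
  proof (rule that[of z])
    show "(\<lambda>n. \<integral>x. norm (u x - z n x) powr p \<partial>lebesgue_on S) \<longlonglongrightarrow> 0"
      by (rule tendsto_sandwich[OF _ _ tendsto_const lim]) auto
    show "(\<lambda>n. \<integral>x. norm (Du x - grad (z n) x) powr p \<partial>lebesgue_on S) \<longlonglongrightarrow> 0"
      by (rule tendsto_sandwich[OF _ _ tendsto_const lim]) auto
  qed (rule z)
qed

lemma lambda1_le:
  assumes "S \<in> sets lebesgue" "\<zeta> \<in> Ccinf (- D)" "x \<in> S" "\<zeta> x \<noteq> 0"
  shows "lambda1 S D p \<le> rayleigh S p \<zeta> (grad \<zeta>)"
  unfolding lambda1_def
proof (rule cInf_lower)
  show "bdd_below {rayleigh S p \<zeta> (grad \<zeta>) |\<zeta>. \<zeta> \<in> Ccinf (- D) \<and> (\<exists>x\<in>S. \<zeta> x \<noteq> 0)}"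
    using rayleigh_nonneg[OF assms(1)] by (intro bdd_belowI[of _ 0]) auto
qed (use assms in auto)

text \<open>The infimum runs over smooth functions while the eigenfunction is only in their closure.
  The inequality for the approximants is multiplied by the denominator and passed to the
  limit.\<close>

lemma lambda1_le_rayleigh:
  fixes S :: "'a::euclidean_space set"
  assumes u: "W1p_D S D p u Du" "nontrivial_on S u"
    and S: "bounded S" "S \<in> sets lebesgue" and p: "1 < p"
  shows "lambda1 S D p \<le> rayleigh S p u Du"
proof -
  note Lu = W1p_D_in_Lp[OF u(1) S(2)]
  obtain z where z: "\<And>n. z n \<in> Ccinf (- D)"
    and lim: "(\<lambda>n. \<integral>x. norm (u x - z n x) powr p \<partial>lebesgue_on S) \<longlonglongrightarrow> 0"
    "(\<lambda>n. \<integral>x. norm (Du x - grad (z n) x) powr p \<partial>lebesgue_on S) \<longlonglongrightarrow> 0"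
    using W1p_D_approx[OF u(1) S(2)] by blast
  have Lz: "in_Lp (lebesgue_on S) p (z n)" "in_Lp (lebesgue_on S) p (grad (z n))" for n
    using Ccinf_in_Lp[OF z S, of p] p by auto
  define N I where "N n = (\<integral>x. norm (grad (z n) x) powr p \<partial>lebesgue_on S)"
    and "I n = (\<integral>x. norm (z n x) powr p \<partial>lebesgue_on S)" for n
  \<comment> \<open>Individual approximants may vanish on \<open>S\<close>; then
    \<open>I n = 0\<close> and the product form still holds.\<close>
  have "lambda1 S D p * I n \<le> N n" for n
  proof (cases "I n = 0")
    case True
    then show ?thesis by (simp add: N_def)
  next
    case False
    moreover have "I n \<ge> 0" by (simp add: I_def)
    ultimately have pos: "I n > 0" by linarith
    have "\<exists>x\<in>S. z n x \<noteq> 0"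
    proof (rule ccontr)
      assume "\<not> (\<exists>x\<in>S. z n x \<noteq> 0)"
      then have "I n = (\<integral>x. 0 \<partial>lebesgue_on S)"
        unfolding I_def by (intro Bochner_Integration.integral_cong) (auto simp: space_restrict_space)
      then show False using pos by simp
    qed
    then obtain x where "x \<in> S" "z n x \<noteq> 0" by blast
    then have "lambda1 S D p \<le> N n / I n"
      using lambda1_le[OF S(2) z] by (auto simp: N_def I_def rayleigh_lebesgue_on[OF S(2)])
    then show ?thesis using pos by (simp add: pos_le_divide_eq)
  qed
  moreover have "I \<longlonglongrightarrow> (\<integral>x. norm (u x) powr p \<partial>lebesgue_on S)"
    unfolding I_def by (rule integral_powr_tendsto[OF p Lu(1) Lz(1) lim(1)])
  moreover have "N \<longlonglongrightarrow> (\<integral>x. norm (Du x) powr p \<partial>lebesgue_on S)"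
    unfolding N_def by (rule integral_powr_tendsto[OF p Lu(2) Lz(2) lim(2)])
  ultimately have "lambda1 S D p * (\<integral>x. norm (u x) powr p \<partial>lebesgue_on S) \<le> (\<integral>x. norm (Du x) powr p \<partial>lebesgue_on S)"
    by (intro LIMSEQ_le[of "\<lambda>n. lambda1 S D p * I n"] tendsto_mult tendsto_const) auto
  moreover have "0 < (\<integral>x. norm (u x) powr p \<partial>lebesgue_on S)"
    using nontrivial_on_iff_integral_pos[OF Lu(1) S(2)] u(2) by simp
  ultimately show ?thesis
    by (simp add: rayleigh_lebesgue_on[OF S(2)] pos_le_divide_eq)
qed

text \<open>Shrinking the support of any test function by an affine map avoids constructing a bump function.\<close>

lemma ex_Ccinf_nonzero_at:
  fixes S :: "'a::euclidean_space set" and y :: 'a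
  assumes \<psi>: "\<psi> \<in> Ccinf A" "\<psi> y \<noteq> 0" and S: "open S" "x \<in> S"
  shows "\<exists>\<zeta>\<in>Ccinf S. \<zeta> x \<noteq> 0"
proof -
  obtain e where e: "e > 0" "ball x e \<subseteq> S" using S open_contains_ball by blast
  have cpt: "compact (supp \<psi>)" "Cinf \<psi>" using \<psi> by (auto simp: Ccinf_def)
  obtain r where r: "r > 0" "\<And>w. w \<in> supp \<psi> \<Longrightarrow> norm w \<le> r"
    using compact_imp_bounded[OF cpt(1)] by (auto simp: bounded_pos)
  \<comment> \<open>The scale is fixed by \<open>c * (e / 2) = r + norm y\<close>, which confines
    the rescaled support to the ball of radius \<open>e / 2\<close>; the shift \<open>a\<close>
    makes the affine map send \<open>x\<close> to \<open>y\<close>.\<close>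
  define c where "c = 2 * (r + norm y) / e"
  have c: "c > 0" using e r by (simp add: c_def add_pos_nonneg)
  define a where "a = y - c *\<^sub>R x"
  define \<zeta> where "\<zeta> w = \<psi> (c *\<^sub>R w + a)" for w
  have sub: "{w. \<zeta> w \<noteq> 0} \<subseteq> cball x (e / 2)"
  proof
    fix w assume "w \<in> {w. \<zeta> w \<noteq> 0}"
    then have "norm (c *\<^sub>R w + a) \<le> r" using r not_in_supp[of "c *\<^sub>R w + a" \<psi>] by (auto simp: \<zeta>_def)
    moreover have "c *\<^sub>R (w - x) = c *\<^sub>R w + a - y" by (simp add: a_def algebra_simps)
    ultimately have "norm (c *\<^sub>R (w - x)) \<le> r + norm y"
      using norm_triangle_ineq4[of "c *\<^sub>R w + a" y] by simp
    then have "c * dist x w \<le> r + norm y"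
      using c by (simp add: dist_norm norm_minus_commute)
    also have "r + norm y = c * (e / 2)" using e by (simp add: c_def)
    finally have "c * dist x w \<le> c * (e / 2)" .
    then show "w \<in> cball x (e / 2)" using c by simp
  qed
  then have supp: "supp \<zeta> \<subseteq> cball x (e / 2)"
    unfolding supp_def by (intro closure_minimal) auto
  have "compact (cball x (e / 2) \<inter> supp \<zeta>)"
    by (intro compact_Int_closed) (auto simp: supp_def)
  then have "compact (supp \<zeta>)" using supp by (simp add: Int_absorb1)
  moreover have "cball x (e / 2) \<subseteq> S" using e by (auto simp: subset_iff)
  moreover have "Cinf \<zeta>" using cpt(2) unfolding \<zeta>_def[abs_def] Cinf_def by (auto intro: Ck_affine)
  moreover have "\<zeta> x \<noteq> 0" using \<psi> by (simp add: \<zeta>_def a_def)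
  ultimately show ?thesis using supp unfolding Ccinf_def by blast
qed

lemma nontrivial_on_continuous:
  fixes S :: "'a::euclidean_space set"
  assumes "open S" "continuous_on UNIV f" "x \<in> S" "f x \<noteq> 0"
  shows "nontrivial_on S f"
proof -
  have "open (S \<inter> {x. f x \<noteq> 0})"
    using assms by (intro open_Int open_Collect_neq) auto
  moreover have "x \<in> S \<inter> {x. f x \<noteq> 0}" using assms by simp
  ultimately have "\<not> negligible (S \<inter> {x. f x \<noteq> 0})" using open_not_negligible by blast
  then have "S \<inter> {x. f x \<noteq> 0} \<notin> null_sets lebesgue" by (simp add: negligible_iff_null_sets)
  moreover have "S \<inter> {x. f x \<noteq> 0} = {x \<in> space lebesgue. \<not> (x \<in> S \<longrightarrow> f x = 0)}" by auto
  ultimately show ?thesis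
    unfolding nontrivial_on_def using \<open>open (S \<inter> {x. f x \<noteq> 0})\<close>
    by (subst AE_iff_null) (auto simp: borel_open)
qed

section \<open>Picone's inequality\<close>

text \<open>The boundary integrand is \<phi> times a nonnegative power of \<open>norm (Du y)\<close>
  times the normal derivative, hence nonnegative almost everywhere, and dropping it from Green's
  formula leaves the supersolution inequality.\<close>

lemma greens_formula_flux_ge:
  fixes S :: "'a::euclidean_space set"
  assumes green: "greens_formula S D (\<lambda>x. p_flux p (Du x))"
    and div: "weak_divergence_on S (\<lambda>x. p_flux p (Du x)) (\<lambda>x. - (R * u x powr (p - 1)))"
    and normal: "AE y in surface_measure. y \<in> frontier S - D \<longrightarrow> outward_normal S y \<bullet> Du y \<ge> 0"
    and \<phi>: "\<phi> \<in> Ccinf (- D)" "\<And>x. \<phi> x \<ge> 0" and S: "S \<in> sets lebesgue"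
  shows "R * (\<integral>x. u x powr (p - 1) * \<phi> x \<partial>lebesgue_on S) \<le> (\<integral>x. p_flux p (Du x) \<bullet> grad \<phi> x \<partial>lebesgue_on S)"
proof -
  have "0 \<le> (LINT y:(frontier S - D)|surface_measure. \<phi> y * (p_flux p (Du y) \<bullet> outward_normal S y))"
    unfolding set_lebesgue_integral_def
  proof (rule integral_nonneg_AE)
    show "AE y in surface_measure. 0 \<le> indicat_real (frontier S - D) y *\<^sub>R (\<phi> y * (p_flux p (Du y) \<bullet> outward_normal S y))"
      using normal
    proof eventually_elim
      case (elim y)
      then show ?case
        using \<phi>(2)[of y] by (auto simp: indicator_def p_flux_def inner_commute)
    qed
  qed
  then have "0 \<le> (LINT x:S|lebesgue. p_flux p (Du x) \<bullet> grad \<phi> x) + (LINT x:S|lebesgue. \<phi> x * - (R * u x powr (p - 1)))"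
    using green[unfolded greens_formula_def, THEN spec, THEN mp, OF div, THEN bspec, OF \<phi>(1), THEN conjunct2] by simp
  then have "0 \<le> (\<integral>x. p_flux p (Du x) \<bullet> grad \<phi> x \<partial>lebesgue_on S) + (\<integral>x. - R * (u x powr (p - 1) * \<phi> x) \<partial>lebesgue_on S)"
    unfolding set_lebesgue_integral_lebesgue_on[OF S] by (simp add: mult_ac)
  then show ?thesis by simp
qed

section \<open>The smooth Picone test function\<close>

text \<open>A smooth approximation of \<open>\<bar>\<zeta>\<bar> powr p / (\<epsilon> + \<bar>w\<bar>) powr (p - 1)\<close> vanishing wherever \<open>\<zeta>\<close> does.\<close>

definition picone_test :: "real \<Rightarrow> real \<Rightarrow> real \<Rightarrow> ('a \<Rightarrow> real) \<Rightarrow> ('a \<Rightarrow> real) \<Rightarrow> 'a \<Rightarrow> real" where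
  "picone_test p \<epsilon> \<delta> \<zeta> w x =
     (((\<zeta> x)\<^sup>2 + \<delta>\<^sup>2) powr (p / 2) - \<delta> powr p) * (\<epsilon> + sqrt ((w x)\<^sup>2 + \<delta>\<^sup>2)) powr (1 - p)"

lemma powr_half_square: "0 < \<delta> \<Longrightarrow> (\<delta>\<^sup>2) powr (p / 2) = \<delta> powr p" for \<delta> p :: real
  by (metis less_imp_le nonzero_mult_div_cancel_left powr_numeral powr_powr times_divide_eq_right zero_neq_numeral)

text \<open>Subtracting \<open>\<delta> powr p\<close> makes the first factor zero wherever \<zeta>
  is zero, so the support stays away from the Dirichlet part. Positive bases make all powers smooth,
  for every real exponent.\<close>

lemma picone_test_in_Ccinf:
  assumes \<zeta>: "\<zeta> \<in> Ccinf A" and w: "Cinf w" and "0 < \<epsilon>" "0 < \<delta>"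
  shows "picone_test p \<epsilon> \<delta> \<zeta> w \<in> Ccinf A"
proof (rule Ccinf_supp_mono[OF \<zeta>])
  have sq: "(w x)\<^sup>2 + \<delta>\<^sup>2 > 0" "(\<zeta> x)\<^sup>2 + \<delta>\<^sup>2 > 0" for x
    using assms by (auto intro: add_nonneg_pos)
  have eq: "picone_test p \<epsilon> \<delta> \<zeta> w = (\<lambda>x. ((\<zeta> x * \<zeta> x + \<delta>\<^sup>2) powr (p / 2) + - (\<delta> powr p))
      * (\<epsilon> + (w x * w x + \<delta>\<^sup>2) powr (1/2)) powr (1 - p))"
    using sq by (simp add: picone_test_def fun_eq_iff powr_half_sqrt less_imp_le power2_eq_square)
  have "Ck k (picone_test p \<epsilon> \<delta> \<zeta> w)" for k
    unfolding eq
    using \<zeta> w sq assms(3)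
    by (intro Ck_mult Ck_add Ck_powr Ck_const)
      (auto simp: Ccinf_def Cinf_def power2_eq_square intro: add_pos_nonneg)
  then show "Cinf (picone_test p \<epsilon> \<delta> \<zeta> w)" by (simp add: Cinf_def)
  show "picone_test p \<epsilon> \<delta> \<zeta> w x = 0" if "\<zeta> x = 0" for x
    using that assms(4) by (simp add: picone_test_def powr_half_square)
qed

text \<open>The quotient of \<open>w x\<close> by the square root is the derivative of the smoothed
  absolute value; it takes the place of the sign of \<open>w x\<close>.\<close>

lemma grad_picone_test:
  assumes \<zeta>: "Cinf \<zeta>" and w: "Cinf w" and "0 < \<epsilon>" "0 < \<delta>"
  defines "H \<equiv> \<lambda>x. (\<zeta> x)\<^sup>2 + \<delta>\<^sup>2" and "V \<equiv> \<lambda>x. \<epsilon> + sqrt ((w x)\<^sup>2 + \<delta>\<^sup>2)"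
  shows "grad (picone_test p \<epsilon> \<delta> \<zeta> w) x =
     (p * H x powr (p / 2 - 1) * \<zeta> x * V x powr (1 - p)) *\<^sub>R grad \<zeta> x
     - ((p - 1) * (H x powr (p / 2) - \<delta> powr p) * V x powr (- p) * (w x / sqrt ((w x)\<^sup>2 + \<delta>\<^sup>2))) *\<^sub>R grad w x"
proof (rule grad_eqI)
  have sq: "(w x)\<^sup>2 + \<delta>\<^sup>2 > 0" "H x > 0" for x
    using assms by (auto intro: add_nonneg_pos)
  have V: "V x > 0" for x using assms(3) by (auto simp: V_def intro: add_pos_nonneg)
  have square: "((\<lambda>x. (f x)\<^sup>2 + \<delta>\<^sup>2) has_derivative (\<lambda>h. ((2 * f x) *\<^sub>R grad f x) \<bullet> h)) (at x)"
    if "Cinf f" for f :: "'a \<Rightarrow> real"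
    by (rule has_derivative_eq_rhs)
      (use Cinf_has_derivative[OF that, of x] in \<open>auto intro!: derivative_eq_intros\<close>)
  have DH: "((\<lambda>x. H x powr (p / 2) - \<delta> powr p) has_derivative
      (\<lambda>h. ((p * H x powr (p / 2 - 1) * \<zeta> x) *\<^sub>R grad \<zeta> x) \<bullet> h)) (at x)"
    using has_derivative_diff[OF has_derivative_powr_grad[OF square[OF \<zeta>], of "p / 2"] has_derivative_const[of "\<delta> powr p"]] sq(2)[of x]
    by (simp add: H_def mult_ac)
  have "((\<lambda>x. ((w x)\<^sup>2 + \<delta>\<^sup>2) powr (1/2)) has_derivative
      (\<lambda>h. ((1/2 * ((w x)\<^sup>2 + \<delta>\<^sup>2) powr (1/2 - 1)) *\<^sub>R ((2 * w x) *\<^sub>R grad w x)) \<bullet> h)) (at x)"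
    by (intro has_derivative_powr_grad square w sq)
  moreover have "((w x)\<^sup>2 + \<delta>\<^sup>2) powr (1/2 - 1) = 1 / sqrt ((w x)\<^sup>2 + \<delta>\<^sup>2)"
    using sq(1)[of x] by (simp add: powr_half_sqrt powr_minus_divide)
  ultimately have "(V has_derivative (\<lambda>h. ((w x / sqrt ((w x)\<^sup>2 + \<delta>\<^sup>2)) *\<^sub>R grad w x) \<bullet> h)) (at x)"
    using has_derivative_add[OF has_derivative_const[of \<epsilon>]] sq(1)
    by (fastforce simp: V_def powr_half_sqrt less_imp_le)
  then have DV: "((\<lambda>x. V x powr (1 - p)) has_derivative
      (\<lambda>h. (((1 - p) * V x powr (1 - p - 1)) *\<^sub>R ((w x / sqrt ((w x)\<^sup>2 + \<delta>\<^sup>2)) *\<^sub>R grad w x)) \<bullet> h)) (at x)"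
    using V by (rule has_derivative_powr_grad)
  define s where "s = w x / sqrt ((w x)\<^sup>2 + \<delta>\<^sup>2)"
  have eq: "picone_test p \<epsilon> \<delta> \<zeta> w = (\<lambda>x. (H x powr (p / 2) - \<delta> powr p) * V x powr (1 - p))"
    by (simp add: picone_test_def H_def V_def fun_eq_iff)
  show "(picone_test p \<epsilon> \<delta> \<zeta> w has_derivative (\<lambda>h.
     ((p * H x powr (p / 2 - 1) * \<zeta> x * V x powr (1 - p)) *\<^sub>R grad \<zeta> x
     - ((p - 1) * (H x powr (p / 2) - \<delta> powr p) * V x powr (- p) * (w x / sqrt ((w x)\<^sup>2 + \<delta>\<^sup>2))) *\<^sub>R grad w x) \<bullet> h)) (at x)"
    unfolding eq s_def[symmetric]
    by (rule has_derivative_eq_rhs[OF has_derivative_mult[OF DH DV[folded s_def]]])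
      (simp add: fun_eq_iff algebra_simps inner_diff_left)
qed

text \<open>Picone's inequality with explicit defects. With \<open>d = grad w x\<close>, quotient
  \<open>w x / sqrt ((w x)\<^sup>2 + \<delta>\<^sup>2)\<close> equal to 1 and no
  \<open>\<delta> powr p\<close>, the negative term would cancel the \<open>norm d\<close> term from
  Young's inequality exactly; each deviation contributes one error term on the right.\<close>

lemma picone_pointwise:
  fixes d :: "'a::euclidean_space"
  assumes p: "1 < p" and \<zeta>: "Cinf \<zeta>" and w: "Cinf w" and \<epsilon>: "0 < \<epsilon>" and \<delta>: "0 < \<delta>"
    and K: "((\<zeta> x)\<^sup>2 + \<delta>\<^sup>2) powr (p / 2) \<le> K"
  shows "p_flux p d \<bullet> grad (picone_test p \<epsilon> \<delta> \<zeta> w) x \<le> norm (grad \<zeta> x) powr p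
    + (p - 1) * \<epsilon> powr (- p) * (norm d powr p * (K * (1 - w x / sqrt ((w x)\<^sup>2 + \<delta>\<^sup>2)) + \<delta> powr p)
      + K * (norm d powr (p - 1) * norm (d - grad w x)))"
proof -
  define H V G s where "H = (\<zeta> x)\<^sup>2 + \<delta>\<^sup>2" and "V = \<epsilon> + sqrt ((w x)\<^sup>2 + \<delta>\<^sup>2)"
    and "G = H powr (p / 2) - \<delta> powr p" and "s = w x / sqrt ((w x)\<^sup>2 + \<delta>\<^sup>2)"
  define Z W F where "Z = grad \<zeta> x" and "W = grad w x" and "F = p_flux p d"
  have H: "H > 0" and sq: "(w x)\<^sup>2 + \<delta>\<^sup>2 > 0" using \<delta> by (auto simp: H_def intro: add_nonneg_pos)
  have V: "V \<ge> \<epsilon>" "V > 0" using \<epsilon> by (auto simp: V_def intro: add_pos_nonneg)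
  have "\<delta> powr p \<le> H powr (p / 2)"
    unfolding powr_half_square[OF \<delta>, symmetric] H_def using p by (intro powr_mono2) auto
  then have G: "0 \<le> G" "G \<le> K"
    using K powr_ge_zero[of \<delta> p] unfolding G_def H_def by linarith+
  have "\<bar>w x\<bar> \<le> sqrt ((w x)\<^sup>2 + \<delta>\<^sup>2)" by (rule real_le_rsqrt) simp
  then have s: "\<bar>s\<bar> \<le> 1" using sq by (simp add: s_def)
  define A B where "A = p * H powr (p / 2 - 1) * \<zeta> x * V powr (1 - p)" and "B = (p - 1) * G * V powr (- p)"
  have B: "B \<ge> 0" using p G by (simp add: B_def)
  \<comment> \<open>The regularised counterpart of the quotient of
    \<open>\<bar>\<zeta>\<bar>\<close> by \<open>u\<close>; Young's inequality is applied to
    \<open>norm d * y\<close> and \<open>norm Z\<close>.\<close>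
  define y where "y = sqrt H / V"
  have y: "y > 0" using H V by (simp add: y_def)
  have yp: "y powr p = H powr (p / 2) * V powr (- p)"
    using H V by (simp add: y_def powr_divide powr_minus_divide flip: powr_half_sqrt) (simp add: powr_powr)
  have ypm: "y powr (p - 1) = H powr (p / 2 - 1) * sqrt H * V powr (1 - p)"
  proof -
    have "y powr (p - 1) = H powr ((p - 1) / 2) * V powr (1 - p)"
      using H V powr_minus_divide[of V "p - 1"] by (simp add: y_def powr_divide flip: powr_half_sqrt) (simp add: powr_powr)
    also have "H powr ((p - 1) / 2) = H powr (p / 2 - 1) * H powr (1 / 2)"
      by (simp add: powr_add[symmetric] field_simps)
    finally show ?thesis using H by (simp add: powr_half_sqrt)
  qed
  have "\<bar>\<zeta> x\<bar> \<le> sqrt H" unfolding H_def by (rule real_le_rsqrt) simp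
  then have "\<bar>A\<bar> \<le> p * y powr (p - 1)"
    using p unfolding A_def ypm by (simp add: abs_mult mult_left_mono mult_right_mono)
  have "A * (F \<bullet> Z) \<le> \<bar>A\<bar> * \<bar>F \<bullet> Z\<bar>" by (metis abs_ge_self abs_mult)
  also have "\<dots> \<le> (p * y powr (p - 1)) * (norm d powr (p - 1) * norm Z)"
    using \<open>\<bar>A\<bar> \<le> _\<close> abs_p_flux_inner_le[of p d Z] p unfolding F_def by (intro mult_mono) auto
  also have "\<dots> = p * ((norm d * y) powr (p - 1) * norm Z)"
    using y by (simp add: powr_mult)
  also have "\<dots> \<le> (p - 1) * (norm d * y) powr p + norm Z powr p"
    using p y by (intro young_powr) auto
  also have "(norm d * y) powr p = norm d powr p * (H powr (p / 2) * V powr (- p))"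
    using y by (simp add: powr_mult yp)
  finally have 1: "A * (F \<bullet> Z) \<le> (p - 1) * (norm d powr p * (H powr (p / 2) * V powr (- p))) + norm Z powr p" .
  \<comment> \<open>Measures the replacement of \<open>W\<close> by \<open>d\<close> in the second
    term: the main part becomes \<open>norm d powr p\<close>, and the remainder is controlled by
    \<open>norm (d - W)\<close>.\<close>
  define m where "m = F \<bullet> (d - W)"
  have "s * m \<le> norm d powr (p - 1) * norm (d - W)"
  proof -
    have "s * m \<le> \<bar>s\<bar> * \<bar>m\<bar>" by (metis abs_ge_self abs_mult)
    also have "\<dots> \<le> 1 * (norm d powr (p - 1) * norm (d - W))"
      using s abs_p_flux_inner_le[of p d "d - W"] unfolding F_def m_def by (intro mult_mono) auto
    finally show ?thesis by simp
  qed
  then have "B * (s * m) \<le> B * (norm d powr (p - 1) * norm (d - W))"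
    using B by (rule mult_left_mono)
  moreover have "F \<bullet> W = norm d powr p - m"
    by (simp add: F_def m_def inner_diff_right p_flux_inner_self)
  then have "- (B * s * (F \<bullet> W)) = - (B * s * norm d powr p) + B * (s * m)"
    by (simp add: right_diff_distrib mult.assoc)
  ultimately have 2: "- (B * s * (F \<bullet> W)) \<le> - (B * s * norm d powr p) + B * (norm d powr (p - 1) * norm (d - W))"
    by linarith
  \<comment> \<open>Collects the mismatch between the power of \<open>H\<close> from Young's
    inequality and \<open>G * s\<close> from the second term: \<open>1 - s\<close> stems from the
    smoothed sign, \<open>\<delta> powr p\<close> from the subtraction in \<open>G\<close>.\<close>
  define q where "q = K * (1 - s) + \<delta> powr p"
  have K0: "K \<ge> 0" using G by simp
  have q: "H powr (p / 2) - G * s \<le> q" "q \<ge> 0"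
  proof -
    have "H powr (p / 2) - G * s = H powr (p / 2) * (1 - s) + \<delta> powr p * s"
      by (simp add: G_def algebra_simps)
    also have "\<dots> \<le> K * (1 - s) + \<delta> powr p * 1"
      using s K by (intro add_mono mult_right_mono mult_left_mono) (auto simp: H_def)
    finally show "H powr (p / 2) - G * s \<le> q" by (simp add: q_def)
    show "q \<ge> 0" using s K0 by (simp add: q_def)
  qed
  \<comment> \<open>The lower bound \<epsilon> for \<open>V\<close> replaces the weight by a
    constant independent of \<open>w\<close>.\<close>
  have Vp: "V powr (- p) \<le> \<epsilon> powr (- p)"
    using V \<epsilon> p by (simp add: powr_minus_divide frac_le powr_mono2)
  have "F \<bullet> grad (picone_test p \<epsilon> \<delta> \<zeta> w) x = A * (F \<bullet> Z) - B * s * (F \<bullet> W)"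
    unfolding grad_picone_test[OF \<zeta> w \<epsilon> \<delta>]
    by (simp add: inner_diff_right A_def B_def G_def H_def V_def s_def Z_def W_def)
  also have "\<dots> \<le> (p - 1) * (norm d powr p * (H powr (p / 2) * V powr (- p))) + norm Z powr p
      - B * s * norm d powr p + B * (norm d powr (p - 1) * norm (d - W))"
    using 1 2 by linarith
  also have "\<dots> = norm Z powr p + (p - 1) * (V powr (- p) * (norm d powr p * (H powr (p / 2) - G * s)))
      + (p - 1) * (V powr (- p) * (G * (norm d powr (p - 1) * norm (d - W))))"
    by (simp add: B_def algebra_simps)
  also have "\<dots> \<le> norm Z powr p + (p - 1) * (\<epsilon> powr (- p) * (norm d powr p * q))
      + (p - 1) * (\<epsilon> powr (- p) * (K * (norm d powr (p - 1) * norm (d - W))))"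
  proof -
    have "V powr (- p) * (norm d powr p * (H powr (p / 2) - G * s)) \<le> V powr (- p) * (norm d powr p * q)"
      using q by (intro mult_left_mono) auto
    also have "\<dots> \<le> \<epsilon> powr (- p) * (norm d powr p * q)"
      using q Vp by (intro mult_right_mono) auto
    finally have "V powr (- p) * (norm d powr p * (H powr (p / 2) - G * s)) \<le> \<epsilon> powr (- p) * (norm d powr p * q)" .
    moreover have "V powr (- p) * (G * (norm d powr (p - 1) * norm (d - W)))
        \<le> \<epsilon> powr (- p) * (K * (norm d powr (p - 1) * norm (d - W)))"
      using G Vp by (intro mult_mono) (auto intro: mult_right_mono)
    ultimately show ?thesis using p by (intro add_mono mult_left_mono) auto
  qed
  also have "\<dots> = norm Z powr p + (p - 1) * \<epsilon> powr (- p) * (norm d powr p * q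
      + K * (norm d powr (p - 1) * norm (d - W)))"
    by (simp add: algebra_simps)
  finally show ?thesis by (simp add: F_def Z_def W_def q_def s_def)
qed

lemma picone_test_bounds:
  assumes "1 < p" "0 < \<epsilon>" "0 < \<delta>" "((\<zeta> x)\<^sup>2 + \<delta>\<^sup>2) powr (p / 2) \<le> K"
  shows "0 \<le> picone_test p \<epsilon> \<delta> \<zeta> w x" "picone_test p \<epsilon> \<delta> \<zeta> w x \<le> K * \<epsilon> powr (1 - p)"
proof -
  have "\<delta> powr p \<le> ((\<zeta> x)\<^sup>2 + \<delta>\<^sup>2) powr (p / 2)"
    unfolding powr_half_square[OF assms(3), symmetric] using assms by (intro powr_mono2) auto
  then show "0 \<le> picone_test p \<epsilon> \<delta> \<zeta> w x" by (simp add: picone_test_def)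
  have "(\<epsilon> + sqrt ((w x)\<^sup>2 + \<delta>\<^sup>2)) powr (1 - p) \<le> \<epsilon> powr (1 - p)"
    using assms by (intro powr_mono2') auto
  moreover have "0 \<le> ((\<zeta> x)\<^sup>2 + \<delta>\<^sup>2) powr (p / 2) - \<delta> powr p"
    "((\<zeta> x)\<^sup>2 + \<delta>\<^sup>2) powr (p / 2) - \<delta> powr p \<le> K"
    using \<open>\<delta> powr p \<le> _\<close> assms(4) powr_ge_zero[of \<delta> p] by linarith+
  ultimately show "picone_test p \<epsilon> \<delta> \<zeta> w x \<le> K * \<epsilon> powr (1 - p)"
    unfolding picone_test_def by (intro mult_mono) auto
qed

lemma picone_test_tendsto:
  assumes "1 < p" "0 < \<epsilon>" and \<delta>: "\<delta> \<longlonglongrightarrow> 0" "\<And>n. 0 < \<delta> n" and w: "(\<lambda>n. w n x) \<longlonglongrightarrow> l"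
  shows "(\<lambda>n. picone_test p \<epsilon> (\<delta> n) \<zeta> (w n) x) \<longlonglongrightarrow> \<bar>\<zeta> x\<bar> powr p * (\<epsilon> + \<bar>l\<bar>) powr (1 - p)"
proof -
  have "(\<lambda>n. (((\<zeta> x)\<^sup>2 + (\<delta> n)\<^sup>2) powr (p / 2) - \<delta> n powr p) * (\<epsilon> + sqrt ((w n x)\<^sup>2 + (\<delta> n)\<^sup>2)) powr (1 - p))
    \<longlonglongrightarrow> (((\<zeta> x)\<^sup>2 + 0\<^sup>2) powr (p / 2) - 0 powr p) * (\<epsilon> + sqrt (l\<^sup>2 + 0\<^sup>2)) powr (1 - p)"
  proof (intro tendsto_mult tendsto_diff)
    \<comment> \<open>The base may tend to 0, namely where \<zeta> vanishes, so continuity of the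
      power rests on the positive exponent; in the other factor \<epsilon> keeps the limit of the
      base away from 0.\<close>
    show "(\<lambda>n. ((\<zeta> x)\<^sup>2 + (\<delta> n)\<^sup>2) powr (p / 2)) \<longlonglongrightarrow> ((\<zeta> x)\<^sup>2 + 0\<^sup>2) powr (p / 2)"
      using assms by (intro tendsto_powr' tendsto_intros) auto
    show "(\<lambda>n. \<delta> n powr p) \<longlonglongrightarrow> 0 powr p"
      using assms by (intro tendsto_powr' tendsto_intros) (auto simp: less_imp_le)
    have "\<epsilon> + sqrt (l\<^sup>2 + 0\<^sup>2) \<noteq> 0" using assms(2) by (simp add: add_pos_nonneg less_imp_neq[symmetric])
    then show "(\<lambda>n. (\<epsilon> + sqrt ((w n x)\<^sup>2 + (\<delta> n)\<^sup>2)) powr (1 - p)) \<longlonglongrightarrow> (\<epsilon> + sqrt (l\<^sup>2 + 0\<^sup>2)) powr (1 - p)"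
      by (intro tendsto_powr tendsto_intros \<delta> w) auto
  qed
  moreover have "((\<zeta> x)\<^sup>2) powr (p / 2) = \<bar>\<zeta> x\<bar> powr p"
    using powr_half_square[of "\<bar>\<zeta> x\<bar>" p] assms by (cases "\<zeta> x = 0") auto
  ultimately show ?thesis by (simp add: picone_test_def)
qed

section \<open>Limits in Picone's inequality\<close>

lemma inverse_Suc_null_seq:
  defines "\<delta> \<equiv> \<lambda>n. 1 / real (Suc n)"
  shows "\<delta> \<longlonglongrightarrow> 0" "0 < \<delta> n" "\<delta> n \<le> 1"
  unfolding \<delta>_def by (rule LIMSEQ_Suc[OF lim_1_over_n]) auto

text \<open>With \<epsilon> fixed, the test functions built from \<open>z n\<close> and
  \<open>\<delta> n\<close> are inserted into the supersolution inequality. The two integrated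
  defects tend to 0: the one with \<open>q n\<close> by dominated convergence, and
  \<open>P n\<close> by \<open>powr_mult_tendsto_0\<close>.\<close>

lemma picone_eps_bound:
  fixes S :: "'a::euclidean_space set"
  assumes S: "bounded S" "S \<in> sets lebesgue" and p: "1 < p" and \<epsilon>: "0 < \<epsilon>"
    and u: "in_Lp (lebesgue_on S) p u" "in_Lp (lebesgue_on S) p Du" "\<forall>x\<in>S. u x > 0"
    and z: "\<And>n. z n \<in> Ccinf A'" "AE x in lebesgue_on S. (\<lambda>n. z n x) \<longlonglongrightarrow> u x"
      "(\<lambda>n. \<integral>x. norm (Du x - grad (z n) x) powr p \<partial>lebesgue_on S) \<longlonglongrightarrow> 0"
    and \<zeta>: "\<zeta> \<in> Ccinf A" and R: "R \<ge> 0"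
    and supersol: "\<And>\<phi>. \<phi> \<in> Ccinf A \<Longrightarrow> (\<And>x. \<phi> x \<ge> 0) \<Longrightarrow>
      R * (\<integral>x. u x powr (p - 1) * \<phi> x \<partial>lebesgue_on S) \<le> (\<integral>x. p_flux p (Du x) \<bullet> grad \<phi> x \<partial>lebesgue_on S)"
  shows "R * (\<integral>x. u x powr (p - 1) * (\<bar>\<zeta> x\<bar> powr p * (\<epsilon> + \<bar>u x\<bar>) powr (1 - p)) \<partial>lebesgue_on S)
    \<le> (\<integral>x. norm (grad \<zeta> x) powr p \<partial>lebesgue_on S)"
proof -
  let ?M = "lebesgue_on S"
  interpret finite_measure ?M using S by (rule finite_measure_lebesgue_on_bounded)
  obtain Z0 where Z0: "\<And>x. \<bar>\<zeta> x\<bar> \<le> Z0" using Ccinf_bounded[OF \<zeta>] by blast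
  \<comment> \<open>Bounds the regularised power of \<zeta> for all \<open>n\<close> at once,
    because \<open>\<delta> n \<le> 1\<close>.\<close>
  define K where "K = (Z0\<^sup>2 + 1) powr (p / 2)"
  have "K \<ge> 0" by (simp add: K_def)
  define \<delta> where "\<delta> n = 1 / real (Suc n)" for n
  have \<delta>: "\<delta> \<longlonglongrightarrow> 0" "\<And>n. 0 < \<delta> n" "\<And>n. \<delta> n \<le> 1"
    using inverse_Suc_null_seq by (auto simp: \<delta>_def[abs_def])
  have K: "((\<zeta> x)\<^sup>2 + (\<delta> n)\<^sup>2) powr (p / 2) \<le> K" for n x
  proof -
    have "(\<zeta> x)\<^sup>2 \<le> Z0\<^sup>2" using power_mono[OF Z0[of x], of 2] by simp
    moreover have "(\<delta> n)\<^sup>2 \<le> 1" using \<delta>(2,3)[of n] by (simp add: power_le_one)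
    ultimately show ?thesis unfolding K_def using p by (intro powr_mono2) auto
  qed
  define \<phi> where "\<phi> n = picone_test p \<epsilon> (\<delta> n) \<zeta> (z n)" for n
  have \<phi>: "\<phi> n \<in> Ccinf A" for n
    unfolding \<phi>_def by (intro picone_test_in_Ccinf \<zeta> Ccinf_Cinf[OF z(1)] \<epsilon> \<delta>)
  have \<phi>_bounds: "0 \<le> \<phi> n x" "\<phi> n x \<le> K * \<epsilon> powr (1 - p)" for n x
    using picone_test_bounds[where \<zeta> = \<zeta> and x = x, OF p \<epsilon> \<delta>(2) K] by (auto simp: \<phi>_def)
  define q where "q n x = K * (1 - z n x / sqrt ((z n x)\<^sup>2 + (\<delta> n)\<^sup>2)) + \<delta> n powr p" for n x
  have Lz: "in_Lp ?M p (grad (z n))" for n using Ccinf_in_Lp[OF z(1) S, of p] p by simp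
  have L\<phi>: "in_Lp ?M p (grad (\<phi> n))" for n using Ccinf_in_Lp[OF \<phi> S, of p] p by simp
  have L\<zeta>: "in_Lp ?M p (grad \<zeta>)" using Ccinf_in_Lp[OF \<zeta> S, of p] p by simp
  have Ld: "in_Lp ?M p (\<lambda>x. Du x - grad (z n) x)" for n
    using in_Lp_diff[OF _ u(2) Lz] p by simp
  have q_meas: "q n \<in> borel_measurable ?M" for n
  proof -
    have "z n \<in> borel_measurable ?M"
      by (intro continuous_imp_measurable_lebesgue_on Cinf_continuous Ccinf_Cinf[OF z(1)])
    then show ?thesis unfolding q_def by measurable
  qed
  have q_bound: "\<bar>q n x\<bar> \<le> 2 * K + 1" for n x
  proof -
    let ?s = "z n x / sqrt ((z n x)\<^sup>2 + (\<delta> n)\<^sup>2)"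
    have "\<bar>z n x\<bar> \<le> sqrt ((z n x)\<^sup>2 + (\<delta> n)\<^sup>2)" by (rule real_le_rsqrt) simp
    moreover have "sqrt ((z n x)\<^sup>2 + (\<delta> n)\<^sup>2) > 0" using \<delta>(2)[of n] by (auto intro: add_nonneg_pos)
    ultimately have s: "\<bar>?s\<bar> \<le> 1" by (simp del: real_sqrt_gt_0_iff)
    from s have "0 \<le> 1 - ?s" "1 - ?s \<le> 2" by linarith+
    then have "0 \<le> K * (1 - ?s)" "K * (1 - ?s) \<le> K * 2"
      using \<open>K \<ge> 0\<close> by (simp_all only: mult_nonneg_nonneg mult_left_mono)
    moreover have "\<delta> n powr p \<le> 1" using powr_mono2[of p "\<delta> n" 1] \<delta>(2,3)[of n] p by simp
    ultimately show ?thesis using powr_ge_zero[of "\<delta> n" p] unfolding q_def by linarith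
  qed
  \<comment> \<open>Positivity of \<open>u\<close> enters here: the smoothed sign of
    \<open>z n x\<close> tends to the sign of \<open>u x\<close>, which is 1.\<close>
  have q_lim: "AE x in ?M. (\<lambda>n. q n x) \<longlonglongrightarrow> 0"
    using z(2) AE_space
  proof eventually_elim
    case (elim x)
    then have "u x > 0" using u(3) by (simp add: space_restrict_space)
    have "(\<lambda>n. q n x) \<longlonglongrightarrow> K * (1 - u x / sqrt ((u x)\<^sup>2 + 0\<^sup>2)) + 0 powr p"
      unfolding q_def using \<open>u x > 0\<close> p
      by (intro tendsto_add tendsto_mult tendsto_diff tendsto_divide tendsto_real_sqrt tendsto_power
          tendsto_const elim(1) \<delta>(1) tendsto_powr') (auto simp: less_imp_le[OF \<delta>(2)])
    then show ?case using \<open>u x > 0\<close> by simp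
  qed
  have Q: "(\<lambda>n. \<integral>x. norm (Du x) powr p * q n x \<partial>?M) \<longlonglongrightarrow> (\<integral>x. 0 \<partial>?M)"
  proof (rule integral_dominated_convergence)
    show "integrable ?M (\<lambda>x. norm (Du x) powr p * (2 * K + 1))"
      using in_Lp_integrable[OF u(2)] by simp
    show "AE x in ?M. (\<lambda>n. norm (Du x) powr p * q n x) \<longlonglongrightarrow> 0"
      using q_lim by eventually_elim (rule tendsto_mult_right_zero)
    show "AE x in ?M. norm (norm (Du x) powr p * q n x) \<le> norm (Du x) powr p * (2 * K + 1)" for n
      using q_bound by (auto simp: abs_mult intro!: mult_left_mono)
    show "(\<lambda>x. norm (Du x) powr p * q n x) \<in> borel_measurable ?M" for n
      using q_meas[of n] in_Lp_measurable[OF u(2)] by measurable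
  qed simp
  define P where "P n = (\<integral>x. norm (Du x) powr (p - 1) * norm (Du x - grad (z n) x) \<partial>?M)" for n
  have P: "P \<longlonglongrightarrow> 0" unfolding P_def by (rule powr_mult_tendsto_0[OF p u(2) Ld z(3)])
  define c where "c = (p - 1) * \<epsilon> powr (- p)"
  define T where "T = (\<integral>x. norm (grad \<zeta> x) powr p \<partial>?M)"
  have le: "R * (\<integral>x. u x powr (p - 1) * \<phi> n x \<partial>?M) \<le> T + c * ((\<integral>x. norm (Du x) powr p * q n x \<partial>?M) + K * P n)" for n
  proof -
    have "R * (\<integral>x. u x powr (p - 1) * \<phi> n x \<partial>?M) \<le> (\<integral>x. p_flux p (Du x) \<bullet> grad (\<phi> n) x \<partial>?M)"
      by (intro supersol \<phi> \<phi>_bounds)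
    also have i: "integrable ?M (\<lambda>x. norm (Du x) powr p * q n x)"
      "integrable ?M (\<lambda>x. norm (Du x) powr (p - 1) * norm (Du x - grad (z n) x))"
      "integrable ?M (\<lambda>x. norm (grad \<zeta> x) powr p)"
      using integrable_mult_bounded[OF in_Lp_integrable[OF u(2)] q_meas q_bound]
        integrable_powr_mult[OF p u(2) Ld] in_Lp_integrable[OF L\<zeta>] by auto
    have "(\<integral>x. p_flux p (Du x) \<bullet> grad (\<phi> n) x \<partial>?M) \<le> (\<integral>x. norm (grad \<zeta> x) powr p
        + c * (norm (Du x) powr p * q n x + K * (norm (Du x) powr (p - 1) * norm (Du x - grad (z n) x))) \<partial>?M)"
      using i integrable_p_flux_inner[OF p u(2) L\<phi>]
        picone_pointwise[OF p Ccinf_Cinf[OF \<zeta>] Ccinf_Cinf[OF z(1)] \<epsilon> \<delta>(2) K]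
      by (intro integral_mono) (auto simp: \<phi>_def c_def q_def)
    also have "\<dots> = T + c * ((\<integral>x. norm (Du x) powr p * q n x \<partial>?M) + K * P n)"
      using i by (simp add: T_def P_def)
    finally show ?thesis .
  qed
  have "(\<lambda>n. T + c * ((\<integral>x. norm (Du x) powr p * q n x \<partial>?M) + K * P n)) \<longlonglongrightarrow> T + c * ((\<integral>x. 0 \<partial>?M) + K * 0)"
    by (intro tendsto_intros Q P)
  moreover have "(\<lambda>n. \<integral>x. u x powr (p - 1) * \<phi> n x \<partial>?M)
      \<longlonglongrightarrow> (\<integral>x. u x powr (p - 1) * (\<bar>\<zeta> x\<bar> powr p * (\<epsilon> + \<bar>u x\<bar>) powr (1 - p)) \<partial>?M)"
  proof (rule integral_dominated_convergence)
    note [measurable] = in_Lp_measurable[OF u(1)]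
    have [measurable]: "\<phi> n \<in> borel_measurable ?M" "\<zeta> \<in> borel_measurable ?M" for n
      by (intro continuous_imp_measurable_lebesgue_on Cinf_continuous Ccinf_Cinf[OF \<phi>] Ccinf_Cinf[OF \<zeta>])+
    show "(\<lambda>x. u x powr (p - 1) * (\<bar>\<zeta> x\<bar> powr p * (\<epsilon> + \<bar>u x\<bar>) powr (1 - p))) \<in> borel_measurable ?M"
      "\<And>n. (\<lambda>x. u x powr (p - 1) * \<phi> n x) \<in> borel_measurable ?M" by measurable
    show "integrable ?M (\<lambda>x. norm (u x) powr (p - 1) * (K * \<epsilon> powr (1 - p)))"
      using integrable_powr_minus_one[OF p u(1)] by simp
    show "AE x in ?M. (\<lambda>n. u x powr (p - 1) * \<phi> n x) \<longlonglongrightarrow> u x powr (p - 1) * (\<bar>\<zeta> x\<bar> powr p * (\<epsilon> + \<bar>u x\<bar>) powr (1 - p))"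
      using z(2) unfolding \<phi>_def
      by eventually_elim (intro tendsto_mult tendsto_const picone_test_tendsto p \<epsilon> \<delta>)
    have "norm (u x powr (p - 1) * \<phi> n x) \<le> norm (u x) powr (p - 1) * (K * \<epsilon> powr (1 - p))" if "x \<in> S" for n x
      using \<phi>_bounds[of n x] u(3) that by (auto simp: abs_mult less_imp_le intro!: mult_mono)
    then show "AE x in ?M. norm (u x powr (p - 1) * \<phi> n x) \<le> norm (u x) powr (p - 1) * (K * \<epsilon> powr (1 - p))" for n
      by (intro AE_I2) (simp add: space_restrict_space)
  qed
  then have "(\<lambda>n. R * (\<integral>x. u x powr (p - 1) * \<phi> n x \<partial>?M))
      \<longlonglongrightarrow> R * (\<integral>x. u x powr (p - 1) * (\<bar>\<zeta> x\<bar> powr p * (\<epsilon> + \<bar>u x\<bar>) powr (1 - p)) \<partial>?M)"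
    by (intro tendsto_intros)
  ultimately have "R * (\<integral>x. u x powr (p - 1) * (\<bar>\<zeta> x\<bar> powr p * (\<epsilon> + \<bar>u x\<bar>) powr (1 - p)) \<partial>?M)
      \<le> T + c * ((\<integral>x. 0 \<partial>?M) + K * 0)"
    using le by (intro LIMSEQ_le) auto
  then show ?thesis by (simp add: T_def)
qed

text \<open>As \<epsilon> tends to 0 the powers of \<open>u\<close> cancel on \<open>S\<close>.
  Since the exponent \<open>1 - p\<close> is negative, omitting \<epsilon> only increases the
  integrand, so \<open>\<bar>\<zeta> x\<bar> powr p\<close> is a majorant.\<close>

lemma picone_rayleigh_bound:
  fixes S :: "'a::euclidean_space set"
  assumes S: "bounded S" "S \<in> sets lebesgue" and p: "1 < p"
    and u: "in_Lp (lebesgue_on S) p u" "in_Lp (lebesgue_on S) p Du" "\<forall>x\<in>S. u x > 0"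
    and z: "\<And>n. z n \<in> Ccinf A'" "AE x in lebesgue_on S. (\<lambda>n. z n x) \<longlonglongrightarrow> u x"
      "(\<lambda>n. \<integral>x. norm (Du x - grad (z n) x) powr p \<partial>lebesgue_on S) \<longlonglongrightarrow> 0"
    and \<zeta>: "\<zeta> \<in> Ccinf A" and R: "R \<ge> 0"
    and supersol: "\<And>\<phi>. \<phi> \<in> Ccinf A \<Longrightarrow> (\<And>x. \<phi> x \<ge> 0) \<Longrightarrow>
      R * (\<integral>x. u x powr (p - 1) * \<phi> x \<partial>lebesgue_on S) \<le> (\<integral>x. p_flux p (Du x) \<bullet> grad \<phi> x \<partial>lebesgue_on S)"
  shows "R * (\<integral>x. \<bar>\<zeta> x\<bar> powr p \<partial>lebesgue_on S) \<le> (\<integral>x. norm (grad \<zeta> x) powr p \<partial>lebesgue_on S)"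
proof -
  let ?M = "lebesgue_on S"
  define \<epsilon> where "\<epsilon> n = 1 / real (Suc n)" for n
  have \<epsilon>: "\<epsilon> \<longlonglongrightarrow> 0" "\<And>n. 0 < \<epsilon> n"
    using inverse_Suc_null_seq by (auto simp: \<epsilon>_def[abs_def])
  define I where "I n = (\<integral>x. u x powr (p - 1) * (\<bar>\<zeta> x\<bar> powr p * (\<epsilon> n + \<bar>u x\<bar>) powr (1 - p)) \<partial>?M)" for n
  have "I \<longlonglongrightarrow> (\<integral>x. \<bar>\<zeta> x\<bar> powr p \<partial>?M)"
    unfolding I_def
  proof (rule integral_dominated_convergence)
    have L\<zeta>: "in_Lp ?M p \<zeta>" using Ccinf_in_Lp[OF \<zeta> S, of p] p by simp
    note [measurable] = in_Lp_measurable[OF u(1)] in_Lp_measurable[OF L\<zeta>]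
    show "(\<lambda>x. \<bar>\<zeta> x\<bar> powr p) \<in> borel_measurable ?M"
      "\<And>n. (\<lambda>x. u x powr (p - 1) * (\<bar>\<zeta> x\<bar> powr p * (\<epsilon> n + \<bar>u x\<bar>) powr (1 - p))) \<in> borel_measurable ?M" by measurable
    show "integrable ?M (\<lambda>x. \<bar>\<zeta> x\<bar> powr p)" using in_Lp_integrable[OF L\<zeta>] by simp
    have cancel: "u x powr (p - 1) * u x powr (1 - p) = 1" if "x \<in> S" for x
      using bspec[OF u(3) that] by (simp add: powr_add[symmetric])
    have "(\<lambda>n. u x powr (p - 1) * (\<bar>\<zeta> x\<bar> powr p * (\<epsilon> n + \<bar>u x\<bar>) powr (1 - p))) \<longlonglongrightarrow> \<bar>\<zeta> x\<bar> powr p" if "x \<in> S" for x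
    proof -
      have pos: "u x > 0" using u(3) that by blast
      have "(\<lambda>n. u x powr (p - 1) * (\<bar>\<zeta> x\<bar> powr p * (\<epsilon> n + \<bar>u x\<bar>) powr (1 - p)))
          \<longlonglongrightarrow> u x powr (p - 1) * (\<bar>\<zeta> x\<bar> powr p * (0 + \<bar>u x\<bar>) powr (1 - p))"
        using pos by (intro tendsto_mult tendsto_const tendsto_powr tendsto_add \<epsilon>) auto
      then show ?thesis using pos cancel[OF that] by (simp add: mult.left_commute)
    qed
    then show "AE x in ?M. (\<lambda>n. u x powr (p - 1) * (\<bar>\<zeta> x\<bar> powr p * (\<epsilon> n + \<bar>u x\<bar>) powr (1 - p))) \<longlonglongrightarrow> \<bar>\<zeta> x\<bar> powr p"
      by (intro AE_I2) (simp add: space_restrict_space)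
    have "u x powr (p - 1) * (\<bar>\<zeta> x\<bar> powr p * (\<epsilon> n + \<bar>u x\<bar>) powr (1 - p)) \<le> \<bar>\<zeta> x\<bar> powr p" if "x \<in> S" for n x
    proof -
      have pos: "u x > 0" using u(3) that by blast
      have "(\<epsilon> n + \<bar>u x\<bar>) powr (1 - p) \<le> u x powr (1 - p)"
        using pos p \<epsilon>(2)[of n] by (intro powr_mono2') auto
      then have "u x powr (p - 1) * (\<bar>\<zeta> x\<bar> powr p * (\<epsilon> n + \<bar>u x\<bar>) powr (1 - p))
          \<le> u x powr (p - 1) * (\<bar>\<zeta> x\<bar> powr p * u x powr (1 - p))"
        by (intro mult_left_mono) auto
      then show ?thesis using cancel[OF that] by (simp add: mult.left_commute)
    qed
    then show "AE x in ?M. norm (u x powr (p - 1) * (\<bar>\<zeta> x\<bar> powr p * (\<epsilon> n + \<bar>u x\<bar>) powr (1 - p))) \<le> \<bar>\<zeta> x\<bar> powr p" for n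
      by (intro AE_I2) (simp add: space_restrict_space)
  qed
  then have "(\<lambda>n. R * I n) \<longlonglongrightarrow> R * (\<integral>x. \<bar>\<zeta> x\<bar> powr p \<partial>?M)" by (intro tendsto_intros)
  moreover have "R * I n \<le> (\<integral>x. norm (grad \<zeta> x) powr p \<partial>?M)" for n
    unfolding I_def by (rule picone_eps_bound[OF S p \<epsilon>(2) u z \<zeta> R supersol])
  ultimately show ?thesis by (intro LIMSEQ_le_const2) auto
qed

theorem mainTheorem2:
  fixes \<Omega> \<Omega>\<^sub>D \<Upsilon> \<Upsilon>\<^sub>D :: "'a::euclidean_space set"
    and p :: real and u :: "'a \<Rightarrow> real" and Du :: "'a \<Rightarrow> 'a"
  assumes p: "1 < p"
    and \<Omega>: "regular_domain \<Omega> \<Omega>\<^sub>D"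
    and \<Upsilon>: "regular_domain \<Upsilon> \<Upsilon>\<^sub>D"
    and subset: "\<Omega> \<subseteq> \<Upsilon>"
    and eigenfunction: "fundamental_eigenfunction \<Upsilon> \<Upsilon>\<^sub>D p u Du"
    and positive: "\<forall>x\<in>\<Omega>. u x > 0"
    and boundary_values:
      "AE y in surface_measure. y \<in> frontier \<Omega> - \<Omega>\<^sub>D \<longrightarrow> boundary_value_at \<Omega> Du y"
    and green: "greens_formula \<Omega> \<Omega>\<^sub>D (\<lambda>x. p_flux p (Du x))"
    and normal_derivative:
      "AE y in surface_measure. y \<in> frontier \<Omega> - \<Omega>\<^sub>D \<longrightarrow> outward_normal \<Omega> y \<bullet> Du y \<ge> 0"
  shows "lambda1 \<Omega> \<Omega>\<^sub>D p \<ge> lambda1 \<Upsilon> \<Upsilon>\<^sub>D p"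
proof -
  have O: "open \<Omega>" "bounded \<Omega>" "\<Omega> \<noteq> {}" "\<Omega>\<^sub>D \<subseteq> frontier \<Omega>" "\<Omega> \<in> sets lebesgue"
    and Y: "open \<Upsilon>" "bounded \<Upsilon>" "\<Upsilon>\<^sub>D \<subseteq> frontier \<Upsilon>" "\<Upsilon> \<in> sets lebesgue"
    using \<Omega> \<Upsilon> by (auto simp: regular_domain_def)
  have W: "W1p_D \<Upsilon> \<Upsilon>\<^sub>D p u Du" and nt: "nontrivial_on \<Upsilon> u"
    using eigenfunction by (auto simp: fundamental_eigenfunction_def)
  note LY = W1p_D_in_Lp[OF W Y(4)]
  have LO: "in_Lp (lebesgue_on \<Omega>) p u" "in_Lp (lebesgue_on \<Omega>) p Du"
    using in_Lp_subset[OF _ O(5) Y(4) subset] LY by auto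
  define R where "R = rayleigh \<Upsilon> p u Du"
  have R: "R \<ge> 0" unfolding R_def by (rule rayleigh_nonneg[OF Y(4)])
  have supersol: "R * (\<integral>x. u x powr (p - 1) * \<phi> x \<partial>lebesgue_on \<Omega>)
      \<le> (\<integral>x. p_flux p (Du x) \<bullet> grad \<phi> x \<partial>lebesgue_on \<Omega>)"
    if "\<phi> \<in> Ccinf (- \<Omega>\<^sub>D)" "\<And>x. \<phi> x \<ge> 0" for \<phi>
    unfolding R_def
    by (rule greens_formula_flux_ge[OF green _ normal_derivative that O(5)])
      (rule eigenfunction_weak_divergence[OF eigenfunction Y(1-3) O(1) subset positive p])
  obtain z where z: "\<And>n. z n \<in> Ccinf (- \<Upsilon>\<^sub>D)"
    and limY: "(\<lambda>n. \<integral>x. norm (u x - z n x) powr p \<partial>lebesgue_on \<Upsilon>) \<longlonglongrightarrow> 0"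
    "(\<lambda>n. \<integral>x. norm (Du x - grad (z n) x) powr p \<partial>lebesgue_on \<Upsilon>) \<longlonglongrightarrow> 0"
    using W1p_D_approx[OF W Y(4)] by blast
  have LzY: "in_Lp (lebesgue_on \<Upsilon>) p (z n)" "in_Lp (lebesgue_on \<Upsilon>) p (grad (z n))" for n
    using Ccinf_in_Lp[OF z Y(2,4), of p] p by auto
  have LzO: "in_Lp (lebesgue_on \<Omega>) p (z n)" for n
    using in_Lp_subset[OF LzY(1) O(5) Y(4) subset] .
  have restrict: "(\<lambda>n. \<integral>x. norm (d n x) powr p \<partial>lebesgue_on \<Omega>) \<longlonglongrightarrow> 0"
    if "\<And>n. in_Lp (lebesgue_on \<Upsilon>) p (d n)" "(\<lambda>n. \<integral>x. norm (d n x) powr p \<partial>lebesgue_on \<Upsilon>) \<longlonglongrightarrow> 0"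
    for d :: "nat \<Rightarrow> 'a \<Rightarrow> 'c::euclidean_space"
    by (rule tendsto_sandwich[OF _ _ tendsto_const that(2)])
      (auto intro!: always_eventually integral_lebesgue_on_mono_set in_Lp_integrable that(1) O(5) Y(4) subset)
  have lim: "(\<lambda>n. \<integral>x. norm (u x - z n x) powr p \<partial>lebesgue_on \<Omega>) \<longlonglongrightarrow> 0"
    "(\<lambda>n. \<integral>x. norm (Du x - grad (z n) x) powr p \<partial>lebesgue_on \<Omega>) \<longlonglongrightarrow> 0"
    using restrict[OF in_Lp_diff[OF _ LY(1) LzY(1)] limY(1)] restrict[OF in_Lp_diff[OF _ LY(2) LzY(2)] limY(2)] p
    by auto
  \<comment> \<open>Picone's inequality needs pointwise convergence of the denominators almost
    everywhere, which mean convergence gives only along a subsequence; the gradients still converge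
    along it.\<close>
  obtain r where r: "strict_mono r" "AE x in lebesgue_on \<Omega>. (\<lambda>n. z (r n) x) \<longlonglongrightarrow> u x"
    using Lp_tendsto_AE_subseq[OF p LO(1) LzO lim(1)] by blast
  have lim_r: "(\<lambda>n. \<integral>x. norm (Du x - grad (z (r n)) x) powr p \<partial>lebesgue_on \<Omega>) \<longlonglongrightarrow> 0"
    using LIMSEQ_subseq_LIMSEQ[OF lim(2) r(1)] by (simp add: o_def)
  have "R \<le> rayleigh \<Omega> p \<zeta> (grad \<zeta>)" if \<zeta>: "\<zeta> \<in> Ccinf (- \<Omega>\<^sub>D)" "x \<in> \<Omega>" "\<zeta> x \<noteq> 0" for \<zeta> x
  proof -
    have "R * (\<integral>x. \<bar>\<zeta> x\<bar> powr p \<partial>lebesgue_on \<Omega>) \<le> (\<integral>x. norm (grad \<zeta> x) powr p \<partial>lebesgue_on \<Omega>)"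
      by (rule picone_rayleigh_bound[OF O(2,5) p LO positive z r(2) lim_r \<zeta>(1) R supersol])
    moreover have "nontrivial_on \<Omega> \<zeta>"
      by (rule nontrivial_on_continuous[OF O(1) Cinf_continuous[OF Ccinf_Cinf[OF \<zeta>(1)]] \<zeta>(2,3)])
    then have "0 < (\<integral>x. \<bar>\<zeta> x\<bar> powr p \<partial>lebesgue_on \<Omega>)"
      using nontrivial_on_iff_integral_pos[OF Ccinf_in_Lp(1)[OF \<zeta>(1) O(2,5)] O(5)] p by simp
    ultimately show ?thesis by (simp add: rayleigh_lebesgue_on[OF O(5)] pos_le_divide_eq)
  qed
  \<comment> \<open>A lower bound passes to the infimum only over a nonempty set of quotients. Some
    \<open>z n\<close> is not identically zero, since otherwise \<open>u\<close> would be trivial on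
    \<Upsilon>; a rescaled copy of it fits into \<Omega>.\<close>
  moreover have "\<exists>\<zeta>. \<zeta> \<in> Ccinf (- \<Omega>\<^sub>D) \<and> (\<exists>x\<in>\<Omega>. \<zeta> x \<noteq> 0)"
  proof -
    obtain n y where "z n y \<noteq> 0"
    proof (rule ccontr)
      assume "\<not> thesis"
      then have "z = (\<lambda>n x. 0)" using that by blast
      then have "(\<lambda>n. \<integral>x. \<bar>u x\<bar> powr p \<partial>lebesgue_on \<Upsilon>) \<longlonglongrightarrow> 0" using limY(1) by simp
      then show False
        using nontrivial_on_iff_integral_pos[OF LY(1) Y(4)] nt by (simp add: LIMSEQ_const_iff)
    qed
    moreover obtain x where "x \<in> \<Omega>" using O(3) by blast
    ultimately obtain \<zeta> where "\<zeta> \<in> Ccinf \<Omega>" "\<zeta> x \<noteq> 0"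
      using ex_Ccinf_nonzero_at[OF z _ O(1)] by blast
    moreover have "\<Omega> \<subseteq> - \<Omega>\<^sub>D" using O frontier_disjoint_eq[of \<Omega>] by auto
    ultimately show ?thesis using \<open>x \<in> \<Omega>\<close> Ccinf_mono by blast
  qed
  ultimately have "R \<le> lambda1 \<Omega> \<Omega>\<^sub>D p"
    unfolding lambda1_def by (intro cInf_greatest) auto
  moreover have "lambda1 \<Upsilon> \<Upsilon>\<^sub>D p \<le> R"
    unfolding R_def by (rule lambda1_le_rayleigh[OF W nt Y(2,4) p])
  ultimately show ?thesis by linarith
qed

end
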